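(* Let $\varphi=0$ and $\psi=0$ be plane algebraic curves of orders $p$ and $q$, meeting in $pq$ intersections, and let $f=0$ be the equation of a curve of order $n$ that passes through the $pq$ intersections of $\varphi=0$ and $\psi=0$, with multiplicity $\alpha+\beta-1$ at each point common to the two curves, where $\alpha$ and $\beta$ denote the multiplicities with which $\varphi=0$ and $\psi=0$, respectively, pass through that point. Then $f$ can be put in the form $$f=A\varphi+B\psi,$$ where $A$ and $B$ are polynomials (in homogeneous coordinates, of degrees $n-p$ and $n-q$) such that, at each such common point, the curve $A=0$ passes through the point with multiplicity $\beta-1$ and the curve $B=0$ passes through the point with multiplicity $\alpha-1$.
   Context: The curves lie in the complex projective plane and $f,\varphi,\psi,A,B$ are regarded as homogeneous polynomials in the homogeneous coordinates. The curves $\varphi=0$ and $\psi=0$ have no common component, and their $pq$ intersections are counted as in Bézout's theorem. The integers $\alpha,\beta$ depend on the common point considered. To pass through a point with multiplicity $r$ means to have there a point of multiplicity at least $r$, i.e. the local equation of the curve at the point has no terms of degree less than $r$ (no condition if $r=0$; the zero polynomial is allowed for $A$ or $B$).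
   Formalization: The points common to the two curves are taken to include infinitely near ones, where f must also pass with (virtual) multiplicity α+β−1; with proper points only, the claim fails, e.g. φ=Y, ψ=YZ−X², f=X. The conclusion on A and B covers the infinitely near points too. *)

theory Defs
  imports Complex_Main "HOL-Computational_Algebra.Computational_Algebra"
begin

(* Nested univariate polynomials: the outermost indeterminate is X, then Y
   (then Z), so the coefficient of X^i Y^j Z^k in F is
   coeff (coeff (coeff F i) j) k. *)
type_synonym poly2 = "complex poly poly"
type_synonym poly3 = "complex poly poly poly"

abbreviation x2 :: poly2 where "x2 \<equiv> [:0, 1:]"
abbreviation y2 :: poly2 where "y2 \<equiv> [:[:0, 1:]:]"
abbreviation const2 :: "complex \<Rightarrow> poly2" where "const2 a \<equiv> [:[:a:]:]"

definition subst2 :: "poly2 \<Rightarrow> poly2 \<Rightarrow> poly2 \<Rightarrow> poly2" where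
  "subst2 F u v =
     (\<Sum>i\<le>degree F. \<Sum>j\<le>degree (coeff F i). const2 (coeff (coeff F i) j) * u ^ i * v ^ j)"

definition subst3 :: "poly3 \<Rightarrow> poly2 \<Rightarrow> poly2 \<Rightarrow> poly2 \<Rightarrow> poly2" where
  "subst3 F u v w =
     (\<Sum>i\<le>degree F. \<Sum>j\<le>degree (coeff F i). \<Sum>k\<le>degree (coeff (coeff F i) j).
        const2 (coeff (coeff (coeff F i) j) k) * u ^ i * v ^ j * w ^ k)"

(* The degree is an integer so that the zero polynomial is the only form of
   negative degree. *)
definition homogeneous :: "int \<Rightarrow> poly3 \<Rightarrow> bool" where
  "homogeneous d F \<longleftrightarrow>
     (\<forall>i j k. coeff (coeff (coeff F i) j) k \<noteq> 0 \<longrightarrow> int (i + j + k) = d)"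

definition plane_curve :: "nat \<Rightarrow> poly3 \<Rightarrow> bool" where
  "plane_curve d F \<longleftrightarrow> d \<ge> 1 \<and> F \<noteq> 0 \<and> homogeneous (int d) F"

(* Homogeneous coordinates (a : b : c) of a point of the plane. *)
type_synonym hcoords = "complex \<times> complex \<times> complex"

(* Equation of F = 0 in affine coordinates centred at the point. *)
fun local_eq :: "poly3 \<Rightarrow> hcoords \<Rightarrow> poly2" where
  "local_eq F (a, b, c) =
     (if c \<noteq> 0 then subst3 F (const2 (a / c) + x2) (const2 (b / c) + y2) 1
      else if b \<noteq> 0 then subst3 F (const2 (a / b) + x2) 1 y2
      else subst3 F 1 x2 y2)"

definition order_at_least :: "nat \<Rightarrow> poly2 \<Rightarrow> bool" where
  "order_at_least r F \<longleftrightarrow> (\<forall>i j. i + j < r \<longrightarrow> coeff (coeff F i) j = 0)"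

(* Only meaningful for F \<noteq> 0. *)
definition local_mult :: "poly2 \<Rightarrow> nat" where
  "local_mult F = (LEAST m. \<exists>i j. i + j = m \<and> coeff (coeff F i) j \<noteq> 0)"

(* "Meeting in pq intersections", counted as in Bezout's theorem, is understood
   in the sense of Max Noether: the points common to two curves include the
   infinitely near ones, and a common point of multiplicities \<alpha> and \<beta> (of the
   strict transforms, where the point is infinitely near) counts
   \<alpha> * \<beta> times; the sum is then pq whenever there is no common component. The
   infinitely near points cannot be dropped: Y = 0 and Y Z - X^2 = 0 have the
   single proper common point (0 : 0 : 1), with \<alpha> = \<beta> = 1, and X = 0 passes
   through it, but X is not of the form A * Y + B * (Y Z - X^2).

   An infinitely near point is given by the successive directions leading to
   it. Slope c is the tangent direction y = c x, Vertical is x = 0; each blow-up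
   is written in coordinates centred at the new point. *)
datatype direction = Slope complex | Vertical

(* Transform for assigned multiplicity r: the pullback of F divided by the r-th
   power of the equation of the exceptional line. The division is exact when
   order_at_least r F. *)
fun transform :: "nat \<Rightarrow> direction \<Rightarrow> poly2 \<Rightarrow> poly2" where
  "transform r (Slope c) F = subst2 F x2 (x2 * (y2 + const2 c)) div x2 ^ r"
| "transform r Vertical F = subst2 F (x2 * y2) y2 div y2 ^ r"

(* In a list of directions the head is the last one taken: the tail of a
   nonempty list is the point that was blown up. *)
fun strict_transform :: "poly2 \<Rightarrow> direction list \<Rightarrow> poly2" where
  "strict_transform F [] = F"
| "strict_transform F (d # ds) =
     transform (local_mult (strict_transform F ds)) d (strict_transform F ds)"

fun virtual_transform :: "(direction list \<Rightarrow> nat) \<Rightarrow> poly2 \<Rightarrow> direction list \<Rightarrow> poly2" where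
  "virtual_transform \<mu> F [] = F"
| "virtual_transform \<mu> F (d # ds) = transform (\<mu> ds) d (virtual_transform \<mu> F ds)"

(* (P, []) is the proper point P of the plane. *)
type_synonym near_point = "hcoords \<times> direction list"

definition multiplicity_at :: "poly3 \<Rightarrow> near_point \<Rightarrow> nat" where
  "multiplicity_at F Q = local_mult (strict_transform (local_eq F (fst Q)) (snd Q))"

definition common_points :: "poly3 \<Rightarrow> poly3 \<Rightarrow> near_point set" where
  "common_points \<phi> \<psi> =
     {Q. fst Q \<noteq> (0, 0, 0) \<and> multiplicity_at \<phi> Q \<ge> 1 \<and> multiplicity_at \<psi> Q \<ge> 1}"

(* At a proper point (P, []) this says that the local equation of F at P has no
   terms of degree less than \<mu> (P, []). At an infinitely near point it is the
   usual notion of passing through it with the assigned (virtual) multiplicity,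
   given the multiplicities assigned to the preceding points. *)
definition passes_through :: "(near_point \<Rightarrow> nat) \<Rightarrow> poly3 \<Rightarrow> near_point \<Rightarrow> bool" where
  "passes_through \<mu> F Q \<longleftrightarrow>
     order_at_least (\<mu> Q)
       (virtual_transform (\<lambda>ds. \<mu> (fst Q, ds)) (local_eq F (fst Q)) (snd Q))"

end

theory Submission
  imports Defs "HOL-Computational_Algebra.Field_as_Ring"
begin

text \<open>At a common point of multiplicities \<open>\<alpha>, \<beta>\<close>, divide the pullbacks to the blow-up of
  \<open>f, \<phi>, \<psi>\<close> by the powers \<open>\<alpha> + \<beta> - 1, \<alpha>, \<beta>\<close> of the equation of the exceptional line. The local
  colength of the two curves drops at every infinitely near point, so by induction the transform
  of \<open>f\<close> lies in the ideal of the strict transforms at each point of the exceptional line. In each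
  of the two charts this gives a representation near the whole line, and two such
  representations differ by a multiple of \<open>(\<psi>, - \<phi>)\<close> whose factor has a pole of order at most one
  along the line. Every Laurent monomial \<open>x ^ i * y ^ j\<close> with \<open>i + j \<ge> -1\<close> has \<open>i \<ge> 0\<close> or \<open>j \<ge> 0\<close>,
  so the representations can be adjusted to agree and descend to \<open>u f = A \<phi> + B \<psi>\<close> with \<open>u\<close>
  nonzero at the point and with \<open>A, B\<close> of multiplicities \<open>\<beta> - 1, \<alpha> - 1\<close>.

  Two representations of the same polynomial differ by a multiple of \<open>(\<psi>, - \<phi>)\<close>, which satisfies
  the multiplicity conditions, so they hold for every representation. It therefore suffices that
  \<open>f\<close> is in the ideal globally; this holds in each affine chart because the ideal of all \<open>u\<close> with
  \<open>u f = A \<phi> + B \<psi>\<close> has no zeros, and the three charts glue because \<open>X ^ K, Y ^ K, Z ^ K\<close> is a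
  regular sequence.\<close>

section \<open>Polynomials in two variables\<close>

text \<open>Constants instead of the abbreviations, so that simplification does not multiply out
  coefficient lists. Identities between polynomials are mostly proved by comparing values with
  \<open>ev2\<close> and \<open>ev3\<close>.\<close>

definition vX :: poly2 where "vX = x2"
definition vY :: poly2 where "vY = y2"
definition kC :: "complex \<Rightarrow> poly2" where "kC a = const2 a"

definition ev2 :: "poly2 \<Rightarrow> complex \<Rightarrow> complex \<Rightarrow> complex" where
  "ev2 F a b = poly (poly F [:a:]) b"

definition ev3 :: "poly3 \<Rightarrow> complex \<Rightarrow> complex \<Rightarrow> complex \<Rightarrow> complex" where
  "ev3 F a b c = poly (poly (poly F [:[:a:]:]) [:b:]) c"

lemma ev2_simps [simp]:
  "ev2 0 a b = 0" "ev2 1 a b = 1"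
  "ev2 (F + G) a b = ev2 F a b + ev2 G a b"
  "ev2 (F - G) a b = ev2 F a b - ev2 G a b"
  "ev2 (- F) a b = - ev2 F a b"
  "ev2 (F * G) a b = ev2 F a b * ev2 G a b"
  "ev2 (F ^ n) a b = ev2 F a b ^ n"
  "ev2 vX a b = a" "ev2 vY a b = b" "ev2 (kC c) a b = c"
  by (simp_all add: ev2_def vX_def vY_def kC_def poly_power)

lemma ev2_sum [simp]: "ev2 (sum f S) a b = (\<Sum>i\<in>S. ev2 (f i) a b)"
  by (induction S rule: infinite_finite_induct) auto

lemma ev3_simps [simp]:
  "ev3 0 a b c = 0" "ev3 1 a b c = 1"
  "ev3 (F + G) a b c = ev3 F a b c + ev3 G a b c"
  "ev3 (F - G) a b c = ev3 F a b c - ev3 G a b c"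
  "ev3 (- F) a b c = - ev3 F a b c"
  "ev3 (F * G) a b c = ev3 F a b c * ev3 G a b c"
  "ev3 (F ^ n) a b c = ev3 F a b c ^ n"
  by (simp_all add: ev3_def poly_power)

text \<open>A nonzero polynomial over an integral domain has finitely many roots, while in
  characteristic 0 there are infinitely many constants.\<close>

lemma poly_eq_0_if_zero_on_constants:
  fixes F :: "'a::{idom,ring_char_0} poly poly"
  assumes "\<And>a. poly F [:a:] = 0"
  shows "F = 0"
proof (rule ccontr)
  assume "F \<noteq> 0"
  then have "finite {x. poly F x = 0}" by (rule poly_roots_finite)
  moreover have "range (\<lambda>a. [:a:]) \<subseteq> {x. poly F x = 0}" using assms by auto
  ultimately have "finite (range (\<lambda>a::'a. [:a:]))" by (rule finite_subset[rotated])
  then have "finite (UNIV :: 'a set)"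
    by (rule finite_imageD) (auto simp: inj_on_def)
  then show False using infinite_UNIV_char_0 by blast
qed

lemma ev2_ext:
  assumes "\<And>a b. ev2 F a b = ev2 G a b"
  shows "F = G"
proof -
  have "poly (F - G) [:a:] = 0" for a
  proof -
    have "\<forall>b. poly (poly (F - G) [:a:]) b = 0" using assms by (simp add: ev2_def)
    then show ?thesis by (simp only: poly_all_0_iff_0)
  qed
  then have "F - G = 0" by (rule poly_eq_0_if_zero_on_constants)
  then show ?thesis by simp
qed

lemma ev3_ext:
  assumes "\<And>a b c. ev3 F a b c = ev3 G a b c"
  shows "F = G"
proof -
  have "poly (F - G) [:[:a:]:] = 0" for a
    by (rule ev2_ext) (use assms in \<open>simp add: ev2_def ev3_def\<close>)
  then have z: "poly (F - G) [:[:a:]:] = 0" for a .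
  show ?thesis
  proof (rule ccontr)
    assume "F \<noteq> G"
    then have "finite {x. poly (F - G) x = 0}" by (intro poly_roots_finite) simp
    moreover have "range (\<lambda>a. [:[:a:]:]) \<subseteq> {x. poly (F - G) x = 0}" using z by auto
    ultimately have "finite (range (\<lambda>a::complex. [:[:a:]:]))" by (rule finite_subset[rotated])
    then have "finite (UNIV :: complex set)"
      by (rule finite_imageD) (auto simp: inj_on_def)
    then show False using infinite_UNIV_char_0 by blast
  qed
qed

lemma ev2_expand:
  "ev2 F a b = (\<Sum>i\<le>degree F. \<Sum>j\<le>degree (coeff F i). coeff (coeff F i) j * a ^ i * b ^ j)"
proof -
  have "poly F [:a:] = (\<Sum>i\<le>degree F. coeff F i * [:a:] ^ i)" by (rule poly_altdef)
  then have "ev2 F a b = (\<Sum>i\<le>degree F. poly (coeff F i) b * a ^ i)"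
    by (simp add: ev2_def poly_sum poly_power)
  also have "\<dots> = (\<Sum>i\<le>degree F. \<Sum>j\<le>degree (coeff F i). coeff (coeff F i) j * a ^ i * b ^ j)"
    by (intro sum.cong refl) (simp add: poly_altdef sum_distrib_left mult_ac)
  finally show ?thesis .
qed

lemma ev3_expand:
  "ev3 F a b c = (\<Sum>i\<le>degree F. \<Sum>j\<le>degree (coeff F i). \<Sum>k\<le>degree (coeff (coeff F i) j).
     coeff (coeff (coeff F i) j) k * a ^ i * b ^ j * c ^ k)"
proof -
  have "poly F [:[:a:]:] = (\<Sum>i\<le>degree F. coeff F i * [:[:a:]:] ^ i)" by (rule poly_altdef)
  then have "ev3 F a b c = (\<Sum>i\<le>degree F. ev2 (coeff F i) b c * a ^ i)"
    by (simp add: ev3_def ev2_def poly_sum poly_power)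
  also have "\<dots> = (\<Sum>i\<le>degree F. \<Sum>j\<le>degree (coeff F i). \<Sum>k\<le>degree (coeff (coeff F i) j).
     coeff (coeff (coeff F i) j) k * a ^ i * b ^ j * c ^ k)"
    by (intro sum.cong refl) (simp add: ev2_expand sum_distrib_left mult_ac)
  finally show ?thesis .
qed

lemma ev2_subst2 [simp]: "ev2 (subst2 F u v) a b = ev2 F (ev2 u a b) (ev2 v a b)"
  by (simp add: ev2_expand[of F] subst2_def kC_def[symmetric])

lemma ev2_subst3 [simp]:
  "ev2 (subst3 F u v w) a b = ev3 F (ev2 u a b) (ev2 v a b) (ev2 w a b)"
  by (simp add: ev3_expand[of F] subst3_def kC_def[symmetric])

abbreviation cf :: "poly2 \<Rightarrow> nat \<Rightarrow> nat \<Rightarrow> complex" where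
  "cf F i j \<equiv> coeff (coeff F i) j"

lemma vX_power: "vX ^ n = monom 1 n"
  by (simp add: vX_def monom_altdef)

lemma vX_power_dvd_iff: "vX ^ n dvd F \<longleftrightarrow> (\<forall>k<n. coeff F k = 0)"
  by (simp add: vX_power monom_1_dvd_iff')

lemma vX_vY_nonzero [simp]: "vX \<noteq> 0" "vY \<noteq> 0" by (simp_all add: vX_def vY_def)

lemma vX_prime: "prime_elem vX"
proof (rule prime_elemI)
  show "vX \<noteq> 0" by simp
  show "\<not> vX dvd 1"
    using vX_power_dvd_iff[of 1 1] by simp
  fix F G assume "vX dvd F * G"
  then have "coeff F 0 * coeff G 0 = 0"
    using vX_power_dvd_iff[of 1 "F * G"] by (simp add: coeff_mult_0)
  then show "vX dvd F \<or> vX dvd G"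
    using vX_power_dvd_iff[of 1 F] vX_power_dvd_iff[of 1 G] by auto
qed

section \<open>Exchange of the coordinates, which turns the vertical direction into slope 0\<close>

definition swp :: "poly2 \<Rightarrow> poly2" where "swp F = subst2 F vY vX"

lemma ev2_swp [simp]: "ev2 (swp F) a b = ev2 F b a" by (simp add: swp_def)

lemma swp_simps [simp]:
  "swp 0 = 0" "swp 1 = 1" "swp (F + G) = swp F + swp G" "swp (F - G) = swp F - swp G"
  "swp (F * G) = swp F * swp G" "swp (F ^ n) = swp F ^ n" "swp (swp F) = F"
  "swp vX = vY" "swp vY = vX" "swp (kC c) = kC c"
  by (rule ev2_ext; simp)+

lemma swp_sum [simp]: "swp (sum f S) = (\<Sum>i\<in>S. swp (f i))"
  by (rule ev2_ext) simp

lemma swp_eq_0_iff [simp]: "swp F = 0 \<longleftrightarrow> F = 0"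
  by (metis swp_simps(7) swp_simps(1))

lemma swp_dvd_iff [simp]: "swp F dvd swp G \<longleftrightarrow> F dvd G"
  by (metis dvd_def swp_simps(5,7))

lemma const_mult_vX_power: "[:p:] * vX ^ n = monom p n"
  by (simp add: vX_power smult_monom)

lemma term_eq_monom:
  "kC a * vX ^ i * vY ^ j = monom (monom a j) i"
proof -
  have "kC a * vX ^ i * vY ^ j = ([:[:a:]:] * [:[:0, 1:] ^ j:]) * vX ^ i"
    by (simp only: kC_def vY_def poly_const_pow mult_ac)
  also have "[:[:a:]:] * [:[:0, 1:] ^ j:] = [:monom a j:]"
    by (simp add: monom_altdef)
  finally show ?thesis by (simp only: const_mult_vX_power)
qed

lemma cf_swp: "cf (swp F) i j = cf F j i"
proof -
  have "swp F = (\<Sum>l\<le>degree F. \<Sum>m\<le>degree (coeff F l). kC (cf F l m) * vX ^ m * vY ^ l)"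
    by (simp add: swp_def subst2_def kC_def mult_ac)
  also have "\<dots> = (\<Sum>l\<le>degree F. \<Sum>m\<le>degree (coeff F l). monom (monom (cf F l m) l) m)"
    by (simp add: term_eq_monom)
  finally have "cf (swp F) i j =
      (\<Sum>l\<le>degree F. \<Sum>m\<le>degree (coeff F l). if m = i then if l = j then cf F l m else 0 else 0)"
    by (simp add: coeff_sum if_distrib[of "\<lambda>p. coeff p j"] cong: if_cong)
  also have "\<dots> = (\<Sum>l\<le>degree F. if l = j then (\<Sum>m\<le>degree (coeff F l). if m = i then cf F l m else 0) else 0)"
    by (intro sum.cong refl) auto
  also have "\<dots> = (if j \<le> degree F then (\<Sum>m\<le>degree (coeff F j). if m = i then cf F j m else 0) else 0)"
    by (subst sum.delta) auto
  also have "\<dots> = cf F j i"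
    by (auto simp: coeff_eq_0)
  finally show ?thesis .
qed

lemma order_at_least_swp [simp]: "order_at_least r (swp F) \<longleftrightarrow> order_at_least r F"
  unfolding order_at_least_def cf_swp by (metis add.commute)

lemma local_mult_swp [simp]: "local_mult (swp F) = local_mult F"
  unfolding local_mult_def cf_swp by (metis add.commute)

lemma vY_prime: "prime_elem vY"
  unfolding prime_elem_def
  by (metis vX_prime prime_elem_def swp_dvd_iff swp_simps(2,5,7,8) vX_vY_nonzero(2))

text \<open>The pullback to the chart of the blow-up whose origin is the direction
  \<open>y = c x\<close>; the exceptional line is \<open>x = 0\<close> there.\<close>

definition pull :: "complex \<Rightarrow> poly2 \<Rightarrow> poly2" where
  "pull c F = subst2 F vX (vX * (vY + kC c))"

lemma ev2_pull [simp]: "ev2 (pull c F) a b = ev2 F a (a * (b + c))"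
  by (simp add: pull_def)

text \<open>A monomial of degree \<open>k\<close> becomes \<open>x ^ k\<close> times a power of
  \<open>y + c\<close>, so the coefficient of \<open>x ^ k\<close> is the homogeneous part of degree
  \<open>k\<close> evaluated at \<open>(1, y + c)\<close>.\<close>

lemma coeff_pull:
  "coeff (pull c F) k = (\<Sum>i\<le>k. smult (cf F i (k - i)) ([:c, 1:] ^ (k - i)))"
proof -
  have yc: "vY + kC c = [:[:c, 1:]:]" by (simp add: vY_def kC_def)
  have t: "kC a * vX ^ i * (vX * (vY + kC c)) ^ j = monom (smult a ([:c, 1:] ^ j)) (i + j)" for a i j
  proof -
    have "kC a * vX ^ i * (vX * (vY + kC c)) ^ j = ([:[:a:]:] * [:[:c, 1:] ^ j:]) * vX ^ (i + j)"
      unfolding yc by (simp only: kC_def poly_const_pow power_mult_distrib power_add mult_ac)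
    also have "[:[:a:]:] * [:[:c, 1:] ^ j:] = [:smult a ([:c, 1:] ^ j):]"
      by simp
    finally show ?thesis by (simp only: const_mult_vX_power)
  qed
  have "pull c F = (\<Sum>i\<le>degree F. \<Sum>j\<le>degree (coeff F i). monom (smult (cf F i j) ([:c, 1:] ^ j)) (i + j))"
    unfolding pull_def subst2_def kC_def[symmetric] t ..
  then have "coeff (pull c F) k =
      (\<Sum>i\<le>degree F. \<Sum>j\<le>degree (coeff F i). if i + j = k then smult (cf F i j) ([:c, 1:] ^ j) else 0)"
    by (simp add: coeff_sum)
  also have "\<dots> = (\<Sum>i\<le>degree F. if i \<le> k then smult (cf F i (k - i)) ([:c, 1:] ^ (k - i)) else 0)"
  proof (intro sum.cong refl)
    fix i
    show "(\<Sum>j\<le>degree (coeff F i). if i + j = k then smult (cf F i j) ([:c, 1:] ^ j) else 0)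
      = (if i \<le> k then smult (cf F i (k - i)) ([:c, 1:] ^ (k - i)) else 0)"
    proof (cases "i \<le> k")
      case True
      then have "(\<Sum>j\<le>degree (coeff F i). if i + j = k then smult (cf F i j) ([:c, 1:] ^ j) else 0)
        = (\<Sum>j\<le>degree (coeff F i). if j = k - i then smult (cf F i j) ([:c, 1:] ^ j) else 0)"
        by (intro sum.cong refl) auto
      also have "\<dots> = smult (cf F i (k - i)) ([:c, 1:] ^ (k - i))"
        by (auto simp: coeff_eq_0)
      finally show ?thesis using True by simp
    next
      case False
      then show ?thesis by (auto intro!: sum.neutral)
    qed
  qed
  also have "\<dots> = (\<Sum>i\<in>{..degree F} \<inter> {..k}. smult (cf F i (k - i)) ([:c, 1:] ^ (k - i)))"
    by (subst sum.inter_restrict) (auto intro!: sum.cong)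
  also have "\<dots> = (\<Sum>i\<le>k. smult (cf F i (k - i)) ([:c, 1:] ^ (k - i)))"
    by (intro sum.mono_neutral_left) (auto, metis coeff_0 coeff_eq_0 not_le)
  finally show ?thesis .
qed

lemma pcompose_power: "pcompose (p ^ n) q = pcompose p q ^ n"
  for p :: "'a::comm_ring_1 poly"
  by (induction n) (simp_all add: pcompose_mult pcompose_1)

lemma degree_coeff_pull: "degree (coeff (pull c F) k) \<le> k"
proof -
  have "degree (smult (cf F i (k - i)) ([:c, 1:] ^ (k - i))) \<le> k" for i
    by (rule order_trans[OF degree_smult_le]) (simp add: degree_linear_power)
  then show ?thesis unfolding coeff_pull by (intro degree_sum_le) auto
qed

text \<open>The homogeneous part of degree \<open>k\<close> is recovered from its restriction to
  \<open>x = 1\<close>, and the translation by \<open>c\<close> is injective.\<close>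

lemma coeff_pull_eq_0_iff: "coeff (pull c F) k = 0 \<longleftrightarrow> (\<forall>i\<le>k. cf F i (k - i) = 0)"
proof
  assume *: "coeff (pull c F) k = 0"
  define p where "p = (\<Sum>i\<le>k. monom (cf F i (k - i)) (k - i))"
  have "coeff (pull c F) k = pcompose p [:c, 1:]"
    unfolding coeff_pull p_def pcompose_sum
    by (intro sum.cong refl) (simp add: monom_altdef pcompose_smult pcompose_power pcompose_pCons)
  then have "p = 0" using * by (simp add: pcompose_eq_0_iff)
  show "\<forall>i\<le>k. cf F i (k - i) = 0"
  proof (intro allI impI)
    fix i assume "i \<le> k"
    have "coeff p (k - i) = (\<Sum>l\<le>k. if l = i then cf F l (k - l) else 0)"
      unfolding p_def coeff_sum by (intro sum.cong refl) (use \<open>i \<le> k\<close> in auto)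
    also have "\<dots> = cf F i (k - i)" using \<open>i \<le> k\<close> by simp
    finally show "cf F i (k - i) = 0" using \<open>p = 0\<close> by simp
  qed
qed (simp add: coeff_pull)

text \<open>The order at the origin becomes divisibility by a power of a prime element; products and
  cancellation of orders rest on this.\<close>

lemma order_at_least_iff_pull: "order_at_least r F \<longleftrightarrow> vX ^ r dvd pull c F"
  unfolding vX_power_dvd_iff coeff_pull_eq_0_iff order_at_least_def
  by (metis add_diff_cancel_left' le_add1 le_add_diff_inverse)

section \<open>Blowing up the origin\<close>

lemma poly2_induct [case_names const add multX multY]:
  assumes "\<And>c. P (kC c)" and "\<And>F G. P F \<Longrightarrow> P G \<Longrightarrow> P (F + G)"
    and "\<And>F. P F \<Longrightarrow> P (vX * F)" and "\<And>F. P F \<Longrightarrow> P (vY * F)"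
  shows "P F"
proof -
  have c: "P [:p:]" for p
  proof (induction p)
    case 0
    show ?case using assms(1)[of 0] by (simp add: kC_def)
  next
    case (pCons a p)
    have "[:pCons a p:] = kC a + vY * [:p:]" by (simp add: kC_def vY_def)
    then show ?case using pCons assms by metis
  qed
  show ?thesis
  proof (induction F)
    case 0
    show ?case using assms(1)[of 0] by (simp add: kC_def)
  next
    case (pCons p F)
    have "pCons p F = [:p:] + vX * F" by (simp add: vX_def)
    then show ?case using pCons assms c by metis
  qed
qed

lemma ev2_0_0: "ev2 F 0 0 = cf F 0 0"
  by (simp add: ev2_def poly_0_coeff_0)

lemma order_at_least_local_mult: "order_at_least (local_mult F) F"
  unfolding order_at_least_def local_mult_def
  by (metis (mono_tags, lifting) not_less_Least)

lemma not_order_at_least_Suc_local_mult: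
  assumes "F \<noteq> 0" shows "\<not> order_at_least (Suc (local_mult F)) F"
proof -
  have "\<exists>m i j. i + j = m \<and> cf F i j \<noteq> 0"
    using assms by (metis coeff_0 poly_eqI)
  then have "\<exists>i j. i + j = local_mult F \<and> cf F i j \<noteq> 0"
    unfolding local_mult_def by (rule LeastI_ex)
  then show ?thesis unfolding order_at_least_def by (metis lessI)
qed

lemma order_at_least_mono: "order_at_least r F \<Longrightarrow> s \<le> r \<Longrightarrow> order_at_least s F"
  unfolding order_at_least_def by auto

lemma order_at_least_iff_le_local_mult:
  "F \<noteq> 0 \<Longrightarrow> order_at_least r F \<longleftrightarrow> r \<le> local_mult F"
  by (meson not_less_eq_eq not_order_at_least_Suc_local_mult order_at_least_local_mult order_at_least_mono)

lemma order_at_least_0 [simp]: "order_at_least 0 F"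
  by (simp add: order_at_least_def)

lemma order_at_least_1_iff: "order_at_least 1 F \<longleftrightarrow> ev2 F 0 0 = 0"
  by (auto simp: order_at_least_def ev2_0_0)

lemma pull_simps [simp]:
  "pull c 0 = 0" "pull c 1 = 1" "pull c (F + G) = pull c F + pull c G"
  "pull c (F - G) = pull c F - pull c G" "pull c (F * G) = pull c F * pull c G"
  "pull c (F ^ n) = pull c F ^ n" "pull c vX = vX" "pull c vY = vX * (vY + kC c)"
  "pull c (kC a) = kC a"
  by (rule ev2_ext; simp)+

lemma pull_eq_0_iff [simp]: "pull c F = 0 \<longleftrightarrow> F = 0"
proof
  assume "pull c F = 0"
  then have "cf F i j = 0" for i j
    using coeff_pull_eq_0_iff[of c F "i + j"] by (metis add_diff_cancel_left' coeff_0 le_add1)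
  then show "F = 0" by (intro poly_eqI) simp
qed simp

text \<open>The pullback and, below, the equation of the exceptional line in the chart that belongs
  to \<open>d\<close>; both kinds of direction then share their proofs.\<close>

definition blow_up :: "direction \<Rightarrow> poly2 \<Rightarrow> poly2" where
  "blow_up d F = (case d of Slope c \<Rightarrow> pull c F | Vertical \<Rightarrow> swp (pull 0 (swp F)))"

definition exc_line :: "direction \<Rightarrow> poly2" where
  "exc_line d = (case d of Slope c \<Rightarrow> vX | Vertical \<Rightarrow> vY)"

lemma transform_eq: "transform r d F = blow_up d F div exc_line d ^ r"
proof (cases d)
  case (Slope c)
  then show ?thesis by (simp add: blow_up_def exc_line_def pull_def vX_def vY_def kC_def)
next
  case Vertical
  have "subst2 F (vX * vY) vY = swp (pull 0 (swp F))"
    by (rule ev2_ext) (simp add: mult.commute)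
  then show ?thesis using Vertical by (simp add: blow_up_def exc_line_def vX_def vY_def)
qed

lemma blow_up_simps [simp]:
  "blow_up d 0 = 0" "blow_up d 1 = 1" "blow_up d (F + G) = blow_up d F + blow_up d G"
  "blow_up d (F - G) = blow_up d F - blow_up d G" "blow_up d (F * G) = blow_up d F * blow_up d G"
  "blow_up d (F ^ n) = blow_up d F ^ n" "blow_up d (exc_line d) = exc_line d" "blow_up d (kC a) = kC a"
  "blow_up d F = 0 \<longleftrightarrow> F = 0"
  by (cases d; simp add: blow_up_def exc_line_def)+

lemma blow_up_eq_iff: "blow_up d F = blow_up d G \<longleftrightarrow> F = G"
  by (metis blow_up_simps(4,9) right_minus_eq)

lemma exc_line_prime: "prime_elem (exc_line d)"
  by (cases d) (simp_all add: exc_line_def vX_prime vY_prime)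

lemma exc_line_nonzero [simp]: "exc_line d \<noteq> 0"
  by (cases d) (simp_all add: exc_line_def)

lemma ev2_blow_up_0 [simp]: "ev2 (blow_up d F) 0 0 = ev2 F 0 0"
  by (cases d) (simp_all add: blow_up_def)

lemma order_at_least_iff_blow_up: "order_at_least r F \<longleftrightarrow> exc_line d ^ r dvd blow_up d F"
proof (cases d)
  case (Slope c)
  then show ?thesis by (simp add: blow_up_def exc_line_def order_at_least_iff_pull[of r F c])
next
  case Vertical
  have "order_at_least r F \<longleftrightarrow> vX ^ r dvd pull 0 (swp F)"
    by (simp flip: order_at_least_iff_pull)
  also have "\<dots> \<longleftrightarrow> swp (vX ^ r) dvd swp (pull 0 (swp F))" by (simp only: swp_dvd_iff)
  finally show ?thesis using Vertical by (simp add: blow_up_def exc_line_def)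
qed

lemma blow_up_transform: "order_at_least r F \<Longrightarrow> blow_up d F = exc_line d ^ r * transform r d F"
  unfolding transform_eq order_at_least_iff_blow_up[of _ _ d] by simp

lemma transform_unique: "blow_up d F = exc_line d ^ r * G \<Longrightarrow> transform r d F = G"
  unfolding transform_eq by simp

lemma transform_Vertical:
  assumes "order_at_least r F"
  shows "transform r Vertical F = swp (transform r (Slope 0) (swp F))"
proof (rule transform_unique)
  have "blow_up (Slope 0) (swp F) = exc_line (Slope 0) ^ r * transform r (Slope 0) (swp F)"
    using assms by (intro blow_up_transform) simp
  then have "pull 0 (swp F) = vX ^ r * transform r (Slope 0) (swp F)"
    by (simp add: blow_up_def exc_line_def del: transform.simps)
  then have "swp (pull 0 (swp F)) = vY ^ r * swp (transform r (Slope 0) (swp F))"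
    by (simp del: transform.simps)
  then show "blow_up Vertical F = exc_line Vertical ^ r * swp (transform r (Slope 0) (swp F))"
    by (simp add: blow_up_def exc_line_def del: transform.simps)
qed

text \<open>One more factor in the pullback would raise the order of \<open>F\<close> above its
  multiplicity.\<close>

lemma not_exc_line_dvd_strict:
  assumes "F \<noteq> 0" shows "\<not> exc_line d dvd transform (local_mult F) d F"
proof
  assume "exc_line d dvd transform (local_mult F) d F"
  then have "exc_line d ^ Suc (local_mult F) dvd blow_up d F"
    by (subst blow_up_transform[OF order_at_least_local_mult]) (simp add: mult_dvd_mono mult.commute)
  then show False
    using not_order_at_least_Suc_local_mult[OF assms] order_at_least_iff_blow_up by blast
qed

lemma strict_nonzero: "F \<noteq> 0 \<Longrightarrow> transform (local_mult F) d F \<noteq> 0"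
  by (metis not_exc_line_dvd_strict dvd_0_right)

lemma coprime_prime_power:
  fixes p a :: "'a :: {factorial_ring_gcd, semiring_gcd_mult_normalize}"
  assumes "prime_elem p" "\<not> p dvd a" shows "coprime (p ^ n) a"
  using prime_elem_imp_coprime[OF assms] by simp

lemma order_at_least_add: "order_at_least r F \<Longrightarrow> order_at_least r G \<Longrightarrow> order_at_least r (F + G)"
  by (simp add: order_at_least_def)

lemma order_at_least_diff: "order_at_least r F \<Longrightarrow> order_at_least r G \<Longrightarrow> order_at_least r (F - G)"
  by (simp add: order_at_least_def)

lemma order_at_least_mult:
  "order_at_least r F \<Longrightarrow> order_at_least s G \<Longrightarrow> order_at_least (r + s) (F * G)"
  by (simp add: order_at_least_iff_pull[of _ _ 0] power_add mult_dvd_mono)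

text \<open>The exceptional line is a prime that does not divide the strict transform of
  \<open>G\<close>, so the remaining power of it divides the pullback of \<open>F\<close>.\<close>

lemma order_at_least_cancel:
  assumes "order_at_least (r + local_mult G) (F * G)" "G \<noteq> 0"
  shows "order_at_least r F"
proof -
  define d where "d = Slope 0"
  define G1 where "G1 = transform (local_mult G) d G"
  have "exc_line d ^ (r + local_mult G) dvd blow_up d F * (exc_line d ^ local_mult G * G1)"
    using assms(1) unfolding G1_def blow_up_transform[OF order_at_least_local_mult, symmetric]
    by (simp add: order_at_least_iff_blow_up[of _ _ d])
  then have "exc_line d ^ local_mult G * exc_line d ^ r dvd exc_line d ^ local_mult G * (blow_up d F * G1)"
    by (simp add: power_add mult_ac)
  then have "exc_line d ^ r dvd blow_up d F * G1" by simp
  moreover have "coprime (exc_line d ^ r) G1"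
    unfolding G1_def by (intro coprime_prime_power exc_line_prime not_exc_line_dvd_strict assms)
  ultimately have "exc_line d ^ r dvd blow_up d F" by (simp add: coprime_dvd_mult_left_iff)
  then show ?thesis by (simp add: order_at_least_iff_blow_up[of _ _ d])
qed

lemma pull_lift: "\<exists>K0. \<forall>K\<ge>K0. \<exists>F. pull c F = vX ^ K * g"
proof (induction g rule: poly2_induct)
  case (const a)
  have "pull c (vX ^ K * kC a) = vX ^ K * kC a" for K by simp
  then show ?case by metis
next
  case (add g h)
  then obtain K1 K2 where "\<forall>K\<ge>K1. \<exists>F. pull c F = vX ^ K * g" "\<forall>K\<ge>K2. \<exists>F. pull c F = vX ^ K * h"
    by blast
  then have "\<forall>K\<ge>max K1 K2. \<exists>F. pull c F = vX ^ K * (g + h)"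
    by (metis distrib_left max.bounded_iff pull_simps(3))
  then show ?case by blast
next
  case (multX g)
  then obtain K1 where "\<forall>K\<ge>K1. \<exists>F. pull c F = vX ^ K * g" by blast
  then have "\<forall>K\<ge>K1. \<exists>F. pull c F = vX ^ K * (vX * g)"
    by (metis mult.left_commute pull_simps(5,7))
  then show ?case by blast
next
  case (multY g)
  then obtain K1 where K1: "\<forall>K\<ge>K1. \<exists>F. pull c F = vX ^ K * g" by blast
  have "\<exists>F. pull c F = vX ^ K * (vY * g)" if "K \<ge> Suc K1" for K
  proof -
    obtain L where "K = Suc L" "L \<ge> K1" using \<open>K \<ge> Suc K1\<close> by (cases K) auto
    then obtain F where F: "pull c F = vX ^ L * g" using K1 by blast
    have "pull c ((vY - kC c * vX) * F) = vX ^ K * (vY * g)"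
      by (simp add: F \<open>K = Suc L\<close> algebra_simps)
    then show ?thesis by blast
  qed
  then show ?case by blast
qed

lemma blow_up_lift: "\<exists>K0. \<forall>K\<ge>K0. \<exists>F. blow_up d F = exc_line d ^ K * g"
proof (cases d)
  case (Slope c)
  then show ?thesis using pull_lift[of c g] by (simp add: blow_up_def exc_line_def)
next
  case Vertical
  obtain K0 where K0: "\<forall>K\<ge>K0. \<exists>F. pull 0 F = vX ^ K * swp g" using pull_lift by blast
  have "\<exists>F. swp (pull 0 (swp F)) = vY ^ K * g" if "K \<ge> K0" for K
  proof -
    obtain F where F: "pull 0 F = vX ^ K * swp g" using K0 \<open>K \<ge> K0\<close> by blast
    have "swp (pull 0 (swp (swp F))) = vY ^ K * g" by (simp add: F)
    then show ?thesis by blast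
  qed
  then show ?thesis using Vertical by (auto simp: blow_up_def exc_line_def)
qed

lemma coprime_common_dvd_multiple:
  fixes a b c g :: "'a :: {factorial_ring_gcd, semiring_gcd_mult_normalize}"
  assumes "coprime a b" "g dvd c * a" "g dvd c * b"
  shows "g dvd c"
proof -
  have "g dvd gcd (c * a) (c * b)" using assms by simp
  then show ?thesis using assms(1) by (simp add: gcd_mult_left)
qed

text \<open>A common factor \<open>g\<close> of the transforms, multiplied by a power of
  \<open>exc_line d\<close>, is the pullback of some \<open>G\<close>, which divides the products of
  \<open>\<phi>\<close> and of \<open>\<psi>\<close> with a power of the same coordinate. Hence
  \<open>G\<close> divides a power of this coordinate, and so does \<open>g\<close>; but the strict
  transforms do not contain the exceptional line.\<close>

lemma coprime_strict_transforms:
  assumes "coprime \<phi> \<psi>" and nz: "\<phi> \<noteq> 0" "\<psi> \<noteq> 0"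
  shows "coprime (transform (local_mult \<phi>) d \<phi>) (transform (local_mult \<psi>) d \<psi>)"
proof (rule coprimeI)
  fix g assume g: "g dvd transform (local_mult \<phi>) d \<phi>" "g dvd transform (local_mult \<psi>) d \<psi>"
  obtain K G where G: "blow_up d G = exc_line d ^ K * g" using blow_up_lift by blast
  have *: "\<exists>N. \<forall>M\<ge>N. G dvd exc_line d ^ M * F" if gF: "g dvd transform (local_mult F) d F" for F
  proof -
    obtain e where e: "transform (local_mult F) d F = g * e" using gF by (rule dvdE)
    obtain L where L: "\<forall>M\<ge>L. \<exists>E. blow_up d E = exc_line d ^ M * e" using blow_up_lift by blast
    have "G dvd exc_line d ^ M * F" if "M \<ge> L + K" for M
    proof -
      have "M - K + local_mult F \<ge> L" using that by simp
      then obtain E where E: "blow_up d E = exc_line d ^ (M - K + local_mult F) * e" using L by blast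
      have "blow_up d (G * E) = exc_line d ^ (K + (M - K)) * (exc_line d ^ local_mult F * (g * e))"
        by (simp add: G E power_add mult_ac)
      also have "\<dots> = blow_up d (exc_line d ^ M * F)"
        using that by (simp add: e[symmetric] blow_up_transform[OF order_at_least_local_mult, symmetric])
      finally show ?thesis by (metis dvd_triv_left blow_up_eq_iff)
    qed
    then show ?thesis by blast
  qed
  obtain N1 N2 where "\<forall>M\<ge>N1. G dvd exc_line d ^ M * \<phi>" "\<forall>M\<ge>N2. G dvd exc_line d ^ M * \<psi>"
    using *[OF g(1)] *[OF g(2)] by blast
  then have "G dvd exc_line d ^ max N1 N2"
    by - (rule coprime_common_dvd_multiple[OF assms(1)]; simp)
  then have "blow_up d G dvd blow_up d (exc_line d ^ max N1 N2)" by (metis dvd_def blow_up_simps(5))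
  then have "g dvd exc_line d ^ max N1 N2" unfolding G by (simp add: dvd_mult_right)
  moreover have "coprime (exc_line d ^ max N1 N2) (transform (local_mult \<phi>) d \<phi>)"
    by (intro coprime_prime_power exc_line_prime not_exc_line_dvd_strict nz)
  ultimately show "is_unit g" using g(1) by (meson coprime_common_divisor)
qed

text \<open>The first blow-up is the last entry of the list. Splitting it off there passes from the
  points near the origin to those near a point of the exceptional line.\<close>

lemma strict_transform_append:
  "strict_transform F (ds @ [d]) = strict_transform (transform (local_mult F) d F) ds"
  by (induction ds) simp_all

lemma virtual_transform_append:
  "virtual_transform \<mu> F (ds @ [d]) =
     virtual_transform (\<lambda>ds. \<mu> (ds @ [d])) (transform (\<mu> []) d F) ds"
  by (induction ds) simp_all

section \<open>Ideals generated by two polynomials\<close>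

definition in_ideal :: "'a::comm_ring_1 \<Rightarrow> 'a \<Rightarrow> 'a \<Rightarrow> bool" where
  "in_ideal \<phi> \<psi> g \<longleftrightarrow> (\<exists>A B. g = A * \<phi> + B * \<psi>)"

lemma in_ideal_add: "in_ideal \<phi> \<psi> g \<Longrightarrow> in_ideal \<phi> \<psi> h \<Longrightarrow> in_ideal \<phi> \<psi> (g + h)"
proof -
  assume "in_ideal \<phi> \<psi> g" "in_ideal \<phi> \<psi> h"
  then obtain A B A' B' where "g = A * \<phi> + B * \<psi>" "h = A' * \<phi> + B' * \<psi>"
    by (auto simp: in_ideal_def)
  then have "g + h = (A + A') * \<phi> + (B + B') * \<psi>" by (simp add: algebra_simps)
  then show ?thesis by (auto simp: in_ideal_def)
qed

lemma in_ideal_mult: "in_ideal \<phi> \<psi> g \<Longrightarrow> in_ideal \<phi> \<psi> (a * g)"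
proof -
  assume "in_ideal \<phi> \<psi> g"
  then obtain A B where "g = A * \<phi> + B * \<psi>" by (auto simp: in_ideal_def)
  then have "a * g = (a * A) * \<phi> + (a * B) * \<psi>" by (simp add: algebra_simps)
  then show ?thesis by (auto simp: in_ideal_def)
qed

lemma in_ideal_mult_right: "in_ideal \<phi> \<psi> g \<Longrightarrow> in_ideal \<phi> \<psi> (g * a)"
  using in_ideal_mult[of \<phi> \<psi> g a] by (simp add: mult.commute)

lemma in_ideal_generators [simp]: "in_ideal \<phi> \<psi> \<phi>" "in_ideal \<phi> \<psi> \<psi>" "in_ideal \<phi> \<psi> 0"
proof -
  have "\<phi> = 1 * \<phi> + 0 * \<psi>" "\<psi> = 0 * \<phi> + 1 * \<psi>" "0 = 0 * \<phi> + 0 * \<psi>" by simp_all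
  then show "in_ideal \<phi> \<psi> \<phi>" "in_ideal \<phi> \<psi> \<psi>" "in_ideal \<phi> \<psi> 0" unfolding in_ideal_def by blast+
qed

lemma in_ideal_diff: "in_ideal \<phi> \<psi> g \<Longrightarrow> in_ideal \<phi> \<psi> h \<Longrightarrow> in_ideal \<phi> \<psi> (g - h)"
  using in_ideal_add[of \<phi> \<psi> g "(-1) * h"] in_ideal_mult[of \<phi> \<psi> h "-1"] by simp

lemma in_ideal_swap: "in_ideal \<phi> \<psi> g \<longleftrightarrow> in_ideal \<psi> \<phi> g"
  unfolding in_ideal_def by (metis add.commute)

text \<open>A nonzero element of least degree of the ideal divides both generators up to constants.\<close>

lemma coprime_imp_const_in_ideal:
  fixes f g :: "'a::{factorial_ring_gcd, semiring_gcd_mult_normalize} poly"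
  assumes "coprime f g"
  obtains s where "s \<noteq> 0" "in_ideal f g [:s:]"
proof -
  have "f \<noteq> 0 \<or> g \<noteq> 0" using assms by auto
  then obtain h0 where "h0 \<noteq> 0 \<and> in_ideal f g h0" using in_ideal_generators by metis
  then have "\<exists>h. (h \<noteq> 0 \<and> in_ideal f g h) \<and> (\<forall>h'. h' \<noteq> 0 \<and> in_ideal f g h' \<longrightarrow> degree h \<le> degree h')"
    by (rule ex_has_least_nat)
  then obtain h where h: "h \<noteq> 0" "in_ideal f g h" and
    min: "\<And>h'. h' \<noteq> 0 \<and> in_ideal f g h' \<Longrightarrow> degree h \<le> degree h'"
    by blast
  show thesis
  proof (cases "degree h = 0")
    case True
    then obtain s where "h = [:s:]" by (metis degree_eq_zeroE)
    then show thesis using that h by auto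
  next
    case False
    have nu: "\<not> is_unit (primitive_part h)"
      using False by (metis degree_pCons_0 degree_primitive_part is_unit_poly_iff)
    have "primitive_part h \<noteq> 0" using h by simp
    with nu obtain p where p: "prime p" "p dvd primitive_part h"
      using prime_divisor_exists by blast
    have pe: "prime_elem p" using p by simp
    have pc: "\<not> p dvd [:c:]" if "c \<noteq> 0" for c
    proof
      assume "p dvd [:c:]"
      then have "degree p = 0" using that
        by (metis degree_pCons_0 dvd_imp_degree_le le_0_eq pCons_eq_0_iff)
      then obtain a where a: "p = [:a:]" by (metis degree_eq_zeroE)
      then have "a dvd content (primitive_part h)" using p by (simp add: const_poly_dvd_iff_dvd_content)
      then have "is_unit a" using h by simp
      then show False using pe a by (simp add: prime_elem_def is_unit_poly_iff)
    qed
    have "p dvd h" using p by (metis content_times_primitive_part dvd_smult)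
    have "p dvd F" if F: "in_ideal f g F" for F
    proof -
      \<comment> \<open>Pseudo-division leaves a remainder in the ideal, which vanishes by
        minimality; the constant \<open>c\<close> that it introduces is not divisible by
        \<open>p\<close>.\<close>
      obtain q r where qr: "pseudo_divmod F h = (q, r)" by fastforce
      define c where "c = coeff h (degree h) ^ (Suc (degree F) - degree h)"
      have *: "smult c F = h * q + r" "r = 0 \<or> degree r < degree h"
        using pseudo_divmod[OF h(1) qr] by (auto simp: c_def)
      have "r = [:c:] * F - q * h" using * by (simp add: algebra_simps)
      then have "in_ideal f g r" using F h by (simp only: in_ideal_diff in_ideal_mult)
      then have "r = 0" using * min by force
      then have "p dvd [:c:] * F" using * \<open>p dvd h\<close> by simp
      moreover have "c \<noteq> 0" using h by (simp add: c_def)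
      ultimately show ?thesis using pe pc prime_elem_dvd_multD by blast
    qed
    then have "p dvd f" "p dvd g" by simp_all
    then have "is_unit p" using assms by (meson coprime_common_divisor)
    then show thesis using pe by (simp add: prime_elem_def)
  qed
qed

section \<open>Elimination of one variable and cancellation of factors in \<open>x\<close>\<close>

definition cX :: "complex poly \<Rightarrow> poly2" where
  "cX p = (\<Sum>i\<le>degree p. kC (coeff p i) * vX ^ i)"

lemma ev2_cX [simp]: "ev2 (cX p) a b = poly p a"
  by (simp add: cX_def poly_altdef)

lemma cX_mult [simp]: "cX (p * q) = cX p * cX q"
  by (rule ev2_ext) simp

lemma cX_x_power [simp]: "cX ([:0, 1:] ^ n) = vX ^ n"
  by (rule ev2_ext) (simp add: poly_power)

lemma coprime_swp: "coprime \<phi> \<psi> \<Longrightarrow> coprime (swp \<phi>) (swp \<psi>)"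
  by (rule coprimeI) (metis coprime_common_divisor swp_dvd_iff swp_simps(2,7))

lemma in_ideal_swp: "in_ideal (swp \<phi>) (swp \<psi>) (swp g) \<longleftrightarrow> in_ideal \<phi> \<psi> g"
  unfolding in_ideal_def by (metis swp_simps(3,5,7))

text \<open>\<open>coprime_imp_const_in_ideal\<close> eliminates the outer variable; exchanging the
  coordinates before and after leaves a polynomial in \<open>x\<close> alone.\<close>

lemma coprime_imp_cX_in_ideal:
  assumes "coprime \<phi> \<psi>"
  obtains r where "r \<noteq> 0" "in_ideal \<phi> \<psi> (cX r)"
proof -
  obtain s where s: "s \<noteq> 0" "in_ideal (swp \<phi>) (swp \<psi>) [:s:]"
    using coprime_imp_const_in_ideal[OF coprime_swp[OF assms]] .
  have "swp [:s:] = cX s" by (rule ev2_ext) (simp add: ev2_def[of "[:s:]"])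
  then have "in_ideal \<phi> \<psi> (cX s)" using s(2) by (metis in_ideal_swp swp_simps(7))
  then show thesis using that s by blast
qed

text \<open>A nonzero element of least degree generates the ideal; a root of it would be common to
  all elements, so over the complex numbers it is a constant.\<close>

lemma one_mem_if_no_common_root:
  fixes J :: "complex poly set"
  assumes add: "\<And>p q. p \<in> J \<Longrightarrow> q \<in> J \<Longrightarrow> p + q \<in> J"
    and mult: "\<And>a p. p \<in> J \<Longrightarrow> a * p \<in> J"
    and no_root: "\<And>y. \<exists>p\<in>J. poly p y \<noteq> 0"
  shows "1 \<in> J"
proof -
  obtain g0 where "g0 \<in> J \<and> g0 \<noteq> 0" using no_root by (metis poly_0)
  then have "\<exists>g. (g \<in> J \<and> g \<noteq> 0) \<and> (\<forall>h. h \<in> J \<and> h \<noteq> 0 \<longrightarrow> degree g \<le> degree h)"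
    by (rule ex_has_least_nat)
  then obtain g where g: "g \<in> J" "g \<noteq> 0" and min: "\<And>h. h \<in> J \<and> h \<noteq> 0 \<Longrightarrow> degree g \<le> degree h"
    by blast
  have "degree g = 0"
  proof (rule ccontr)
    assume "degree g \<noteq> 0"
    then obtain z where z: "poly g z = 0"
      using fundamental_theorem_of_algebra[of g] constant_degree[of g] by auto
    obtain p where p: "p \<in> J" "poly p z \<noteq> 0" using no_root by blast
    have "p mod g = p + (- (p div g)) * g" by (simp add: minus_div_mult_eq_mod [symmetric])
    then have "p mod g \<in> J" using add mult p g by metis
    then have "p mod g = 0" using min[of "p mod g"] degree_mod_less[OF g(2), of p] by force
    then have "poly p z = 0" using z by (metis dvd_eq_mod_eq_0 dvd_trans poly_eq_0_iff_dvd)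
    then show False using p by simp
  qed
  then obtain a where a: "g = [:a:]" by (metis degree_eq_zeroE)
  then have "[:1 / a:] * g = 1" using g by simp
  then show ?thesis using mult g by metis
qed

text \<open>The restriction of \<open>U\<close> to the line \<open>x = x0\<close> is an ideal
  without zeros, so \<open>U\<close> contains some \<open>u = 1 + (x - x0) * w\<close>. Then
  \<open>v = v * u - w * (x - x0) * v\<close> lies in \<open>U\<close>.\<close>

lemma ideal_cancel_linear:
  assumes add: "\<And>u v. u \<in> U \<Longrightarrow> v \<in> U \<Longrightarrow> u + v \<in> U"
    and mult: "\<And>a u. u \<in> U \<Longrightarrow> a * u \<in> U"
    and no_zero: "\<And>y. \<exists>u\<in>U. ev2 u x0 y \<noteq> 0"
    and v: "(vX - kC x0) * v \<in> U"
  shows "v \<in> U"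
proof -
  have "1 \<in> (\<lambda>u. poly u [:x0:]) ` U"
  proof (rule one_mem_if_no_common_root)
    fix p q assume "p \<in> (\<lambda>u. poly u [:x0:]) ` U" "q \<in> (\<lambda>u. poly u [:x0:]) ` U"
    then obtain u w where "u \<in> U" "w \<in> U" "p = poly u [:x0:]" "q = poly w [:x0:]" by blast
    then show "p + q \<in> (\<lambda>u. poly u [:x0:]) ` U" using add[of u w] by (metis image_eqI poly_add)
  next
    fix a p assume "p \<in> (\<lambda>u. poly u [:x0:]) ` U"
    then obtain u where "u \<in> U" "p = poly u [:x0:]" by blast
    then have "[:a:] * u \<in> U" by (intro mult)
    moreover have "a * p = poly ([:a:] * u) [:x0:]" using \<open>p = _\<close> by simp
    ultimately show "a * p \<in> (\<lambda>u. poly u [:x0:]) ` U" by blast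
  next
    fix y show "\<exists>p\<in>(\<lambda>u. poly u [:x0:]) ` U. poly p y \<noteq> 0"
      using no_zero[of y] by (auto simp: ev2_def)
  qed
  then obtain u where u: "1 = poly u [:x0:]" "u \<in> U" by (rule imageE)
  then have "poly (u - 1) [:x0:] = 0" by simp
  then have "[:- [:x0:], 1:] dvd u - 1" by (simp only: poly_eq_0_iff_dvd)
  moreover have "[:- [:x0:], 1:] = vX - kC x0" by (simp add: vX_def kC_def)
  ultimately have "vX - kC x0 dvd u - 1" by simp
  then obtain w where "u - 1 = (vX - kC x0) * w" by (rule dvdE)
  then have u1: "u = 1 + (vX - kC x0) * w" by (metis add.commute diff_add_cancel)
  have "v = v * u + (- w) * ((vX - kC x0) * v)" unfolding u1 by (simp add: algebra_simps)
  then show ?thesis using add mult u(2) v by metis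
qed

text \<open>The linear factors of \<open>r\<close> are removed one at a time, each by the absence of
  common zeros of \<open>U\<close> on its line.\<close>

lemma ideal_cancel_cX:
  assumes add: "\<And>u v. u \<in> U \<Longrightarrow> v \<in> U \<Longrightarrow> u + v \<in> U"
    and mult: "\<And>a u. u \<in> U \<Longrightarrow> a * u \<in> U"
    and "r \<noteq> 0" "\<And>x y. poly r x = 0 \<Longrightarrow> \<exists>u\<in>U. ev2 u x y \<noteq> 0" "cX r * v \<in> U"
  shows "v \<in> U"
  using assms(3-)
proof (induction "degree r" arbitrary: r v)
  case 0
  then obtain a where a: "r = [:a:]" "a \<noteq> 0" by (metis degree_eq_zeroE pCons_0_0)
  have "kC (1 / a) * (cX r * v) = v" using a by (intro ev2_ext) simp
  then show ?case using mult 0 by metis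
next
  case (Suc n)
  obtain z where z: "poly r z = 0"
    using fundamental_theorem_of_algebra[of r] constant_degree[of r] Suc(2) by auto
  then obtain s where s: "r = [:- z, 1:] * s" by (metis dvdE poly_eq_0_iff_dvd)
  have "s \<noteq> 0" using s Suc.prems by auto
  have "n = degree s" using Suc(2) \<open>s \<noteq> 0\<close> by (simp add: s degree_mult_eq del: mult_pCons_left)
  moreover have "\<exists>u\<in>U. ev2 u x y \<noteq> 0" if "poly s x = 0" for x y
    using that Suc.prems(2)[of x y] s by simp
  moreover have "cX s * v \<in> U"
  proof (rule ideal_cancel_linear[OF add mult])
    fix y show "\<exists>u\<in>U. ev2 u z y \<noteq> 0" using Suc.prems(2) z by blast
    have "(vX - kC z) * (cX s * v) = cX r * v" by (rule ev2_ext) (simp add: s algebra_simps)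
    then show "(vX - kC z) * (cX s * v) \<in> U" using Suc.prems by argo
  qed auto
  ultimately show ?case using Suc.hyps(1) \<open>s \<noteq> 0\<close> by blast
qed

text \<open>Membership in the ideal generated in the local ring at the origin, with the denominator
  \<open>u\<close> cleared.\<close>

definition in_local_ideal :: "poly2 \<Rightarrow> poly2 \<Rightarrow> poly2 \<Rightarrow> bool" where
  "in_local_ideal \<phi> \<psi> g \<longleftrightarrow> (\<exists>u. ev2 u 0 0 \<noteq> 0 \<and> in_ideal \<phi> \<psi> (u * g))"

lemma in_local_idealI: "ev2 u 0 0 \<noteq> 0 \<Longrightarrow> in_ideal \<phi> \<psi> (u * g) \<Longrightarrow> in_local_ideal \<phi> \<psi> g"
  unfolding in_local_ideal_def by blast

lemma in_ideal_imp_in_local_ideal: "in_ideal \<phi> \<psi> g \<Longrightarrow> in_local_ideal \<phi> \<psi> g"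
  by (rule in_local_idealI[of 1]) simp_all

lemma in_local_ideal_add:
  assumes "in_local_ideal \<phi> \<psi> g" "in_local_ideal \<phi> \<psi> h" shows "in_local_ideal \<phi> \<psi> (g + h)"
proof -
  obtain u v where uv: "ev2 u 0 0 \<noteq> 0" "in_ideal \<phi> \<psi> (u * g)" "ev2 v 0 0 \<noteq> 0" "in_ideal \<phi> \<psi> (v * h)"
    using assms unfolding in_local_ideal_def by blast
  have "u * v * (g + h) = v * (u * g) + u * (v * h)" by (simp add: algebra_simps)
  then have "in_ideal \<phi> \<psi> (u * v * (g + h))" using uv by (simp only: in_ideal_add in_ideal_mult)
  then show ?thesis using uv by (intro in_local_idealI[of "u * v"]) simp_all
qed

lemma in_local_ideal_mult: "in_local_ideal \<phi> \<psi> g \<Longrightarrow> in_local_ideal \<phi> \<psi> (a * g)"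
  unfolding in_local_ideal_def using in_ideal_mult[of \<phi> \<psi> _ a] by (metis mult.left_commute)

lemma in_local_ideal_sum: "(\<And>i. i \<in> S \<Longrightarrow> in_local_ideal \<phi> \<psi> (f i)) \<Longrightarrow> in_local_ideal \<phi> \<psi> (sum f S)"
  by (induction S rule: infinite_finite_induct) (auto intro: in_local_ideal_add in_ideal_imp_in_local_ideal)

lemma in_local_ideal_swap: "in_local_ideal \<phi> \<psi> g \<longleftrightarrow> in_local_ideal \<psi> \<phi> g"
  unfolding in_local_ideal_def by (simp add: in_ideal_swap[of \<phi>])

lemma in_local_ideal_swp: "in_local_ideal (swp \<phi>) (swp \<psi>) (swp g) \<longleftrightarrow> in_local_ideal \<phi> \<psi> g"
  unfolding in_local_ideal_def by (metis ev2_swp in_ideal_swp swp_simps(5,7))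

lemma x_power_factor:
  fixes r :: "complex poly"
  assumes "r \<noteq> 0"
  obtains M s where "r = [:0, 1:] ^ M * s" "poly s 0 \<noteq> 0"
  using order_decomp[OF assms, of 0] that by (metis minus_zero poly_eq_0_iff_dvd)

text \<open>In the elimination polynomial \<open>r = x ^ M * s\<close> the factor \<open>s\<close>
  is a unit of the local ring.\<close>

lemma in_local_ideal_vX_power:
  assumes "coprime \<phi> \<psi>" obtains M where "in_local_ideal \<phi> \<psi> (vX ^ M)"
proof -
  obtain r where r: "r \<noteq> 0" "in_ideal \<phi> \<psi> (cX r)" using coprime_imp_cX_in_ideal[OF assms] .
  obtain M s where s: "r = [:0, 1:] ^ M * s" "poly s 0 \<noteq> 0" using x_power_factor[OF r(1)] .
  have "in_ideal \<phi> \<psi> (cX s * vX ^ M)" using r(2) by (simp add: s(1) mult.commute)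
  then show thesis using that[of M] s(2) in_local_idealI[of "cX s"] by simp
qed

lemma in_local_ideal_vY_power:
  assumes "coprime \<phi> \<psi>" obtains M where "in_local_ideal \<phi> \<psi> (vY ^ M)"
proof -
  obtain M where "in_local_ideal (swp \<phi>) (swp \<psi>) (vX ^ M)" using in_local_ideal_vX_power[OF coprime_swp[OF assms]] .
  then have "in_local_ideal \<phi> \<psi> (swp (vX ^ M))" by (metis in_local_ideal_swp swp_simps(7))
  then show thesis using that by simp
qed

text \<open>The local ring at the origin modulo the two curves has dimension at most \<open>D\<close>.\<close>

definition colength_le :: "nat \<Rightarrow> poly2 \<Rightarrow> poly2 \<Rightarrow> bool" where
  "colength_le D \<phi> \<psi> \<longleftrightarrow> (\<forall>g::nat \<Rightarrow> poly2. \<exists>c. (\<exists>k\<le>D. c k \<noteq> 0) \<and> in_local_ideal \<phi> \<psi> (\<Sum>k\<le>D. kC (c k) * g k))"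

text \<open>Gaussian elimination: the equation \<open>s\<close> is used to eliminate the unknown
  \<open>k0\<close>.\<close>

lemma linear_dependence:
  fixes v :: "'k \<Rightarrow> 's \<Rightarrow> 'a::field"
  assumes "finite S" "finite K" "card S < card K"
  shows "\<exists>c. (\<exists>k\<in>K. c k \<noteq> 0) \<and> (\<forall>s\<in>S. (\<Sum>k\<in>K. c k * v k s) = 0)"
  using assms
proof (induction S arbitrary: K v rule: finite_induct)
  case empty
  then obtain k where "k \<in> K" by fastforce
  then show ?case by (intro exI[of _ "\<lambda>_. 1"]) auto
next
  case (insert s S)
  show ?case
  proof (cases "\<forall>k\<in>K. v k s = 0")
    case True
    obtain c where "\<exists>k\<in>K. c k \<noteq> 0" "\<forall>s\<in>S. (\<Sum>k\<in>K. c k * v k s) = 0"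
      using insert.IH[of K v] insert.prems insert.hyps by auto
    then show ?thesis using True by (intro exI[of _ c]) auto
  next
    case False
    then obtain k0 where k0: "k0 \<in> K" "v k0 s \<noteq> 0" by blast
    define w where "w k t = v k t - v k s / v k0 s * v k0 t" for k t
    have "card S < card (K - {k0})" using insert k0 by simp
    then obtain c where c: "\<exists>k\<in>K - {k0}. c k \<noteq> 0"
        "\<forall>t\<in>S. (\<Sum>k\<in>K - {k0}. c k * w k t) = 0"
      using insert.IH[of "K - {k0}" w] insert.prems by blast
    \<comment> \<open>The value at \<open>k0\<close> is the one that makes the equation
      \<open>s\<close> hold.\<close>
    define d where "d k = (if k = k0 then - (\<Sum>k\<in>K - {k0}. c k * v k s / v k0 s) else c k)" for k
    have *: "(\<Sum>k\<in>K. d k * v k t) = (\<Sum>k\<in>K - {k0}. c k * w k t)" for t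
    proof -
      have "(\<Sum>k\<in>K. d k * v k t) = d k0 * v k0 t + (\<Sum>k\<in>K - {k0}. c k * v k t)"
        using k0 insert.prems by (subst sum.remove[of K k0]) (auto simp: d_def intro!: sum.cong)
      also have "\<dots> = (\<Sum>k\<in>K - {k0}. c k * w k t)"
        by (simp add: d_def w_def algebra_simps sum_subtractf sum_distrib_left sum_distrib_right)
      finally show ?thesis .
    qed
    have "w k s = 0" for k using k0 by (simp add: w_def)
    then have "\<forall>t\<in>insert s S. (\<Sum>k\<in>K. d k * v k t) = 0" using c by (simp add: *)
    moreover have "\<exists>k\<in>K. d k \<noteq> 0" using c(1) by (auto simp: d_def)
    ultimately show ?thesis by blast
  qed
qed

lemma vY_power: "vY ^ n = [:monom 1 n:]"
  by (simp add: vY_def poly_const_pow monom_altdef)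

lemma cutoff_decomposition:
  "\<exists>L H. G = L + vX ^ M * H \<and> (\<forall>i j. cf L i j = (if i < M then cf G i j else 0))"
proof -
  define L where "L = (\<Sum>i<M. monom (coeff G i) i)"
  have L: "coeff L i = (if i < M then coeff G i else 0)" for i
    by (simp add: L_def coeff_sum)
  have "vX ^ M dvd G - L" by (simp add: vX_power_dvd_iff L)
  then obtain H where "G - L = vX ^ M * H" by (rule dvdE)
  then have "G = L + vX ^ M * H" by (simp only: diff_eq_eq add.commute)
  moreover have "\<forall>i j. cf L i j = (if i < M then cf G i j else 0)" by (simp add: L)
  ultimately show ?thesis by blast
qed

lemma vY_power_dvd_iff: "vY ^ n dvd F \<longleftrightarrow> (\<forall>i j. j < n \<longrightarrow> cf F i j = 0)"
  by (auto simp: vY_power const_poly_dvd_iff monom_1_dvd_iff')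

lemma cf_simps: "cf (F + G) i j = cf F i j + cf G i j" "cf (kC a * F) i j = a * cf F i j"
  by (simp_all add: kC_def)

lemma cf_sum: "cf (sum f S) i j = (\<Sum>k\<in>S. cf (f k) i j)"
  by (simp add: coeff_sum)

text \<open>Powers \<open>x ^ M1\<close> and \<open>y ^ M2\<close> lie in the local ideal, so
  \<open>M1 * M2\<close> monomials span the quotient. Making their coefficients vanish is a linear
  system with one more unknown than equations.\<close>

lemma colength_finite:
  assumes "coprime \<phi> \<psi>" obtains D where "colength_le D \<phi> \<psi>"
proof -
  obtain M1 where M1: "in_local_ideal \<phi> \<psi> (vX ^ M1)" using in_local_ideal_vX_power[OF assms] .
  obtain M2 where M2: "in_local_ideal \<phi> \<psi> (vY ^ M2)" using in_local_ideal_vY_power[OF assms] .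
  have "colength_le (M1 * M2) \<phi> \<psi>"
    unfolding colength_le_def
  proof (intro allI)
    fix g :: "nat \<Rightarrow> poly2"
    obtain c where c: "\<exists>k\<in>{..M1 * M2}. c k \<noteq> 0"
      "\<forall>s\<in>{..<M1} \<times> {..<M2}. (\<Sum>k\<le>M1 * M2. c k * cf (g k) (fst s) (snd s)) = 0"
      using linear_dependence[of "{..<M1} \<times> {..<M2}" "{..M1 * M2}" "\<lambda>k s. cf (g k) (fst s) (snd s)"]
      by auto
    define G where "G = (\<Sum>k\<le>M1 * M2. kC (c k) * g k)"
    have G: "cf G i j = 0" if "i < M1" "j < M2" for i j
      using c(2) that by (force simp: G_def cf_sum cf_simps)
    obtain L H where L: "G = L + vX ^ M1 * H" "\<forall>i j. cf L i j = (if i < M1 then cf G i j else 0)"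
      using cutoff_decomposition[of G M1] by blast
    have "vY ^ M2 dvd L" using G by (simp add: vY_power_dvd_iff L(2))
    then obtain L' where "L = vY ^ M2 * L'" by (rule dvdE)
    then have "G = L' * vY ^ M2 + H * vX ^ M1" using L(1) by (simp add: mult.commute)
    then have "in_local_ideal \<phi> \<psi> G" using M1 M2 by (simp only: in_local_ideal_add in_local_ideal_mult)
    then show "\<exists>c. (\<exists>k\<le>M1 * M2. c k \<noteq> 0) \<and> in_local_ideal \<phi> \<psi> (\<Sum>k\<le>M1 * M2. kC (c k) * g k)"
      using c(1) unfolding G_def by auto
  qed
  then show thesis using that by blast
qed

section \<open>Colength of the local ideal\<close>

lemma colength_le_swap: "colength_le D \<phi> \<psi> \<longleftrightarrow> colength_le D \<psi> \<phi>"
  unfolding colength_le_def by (simp add: in_local_ideal_swap[of \<phi>])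

lemma colength_le_swp: "colength_le D \<phi> \<psi> \<Longrightarrow> colength_le D (swp \<phi>) (swp \<psi>)"
  unfolding colength_le_def
proof
  assume *: "\<forall>g. \<exists>c. (\<exists>k\<le>D. c k \<noteq> 0) \<and> in_local_ideal \<phi> \<psi> (\<Sum>k\<le>D. kC (c k) * g k)"
  fix g :: "nat \<Rightarrow> poly2"
  obtain c where "\<exists>k\<le>D. c k \<noteq> 0" "in_local_ideal \<phi> \<psi> (\<Sum>k\<le>D. kC (c k) * swp (g k))"
    using *[rule_format, of "\<lambda>k. swp (g k)"] by blast
  then have "(\<exists>k\<le>D. c k \<noteq> 0) \<and> in_local_ideal (swp \<phi>) (swp \<psi>) (\<Sum>k\<le>D. kC (c k) * g k)"
    by (subst (asm) in_local_ideal_swp[symmetric]) simp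
  then show "\<exists>c. (\<exists>k\<le>D. c k \<noteq> 0) \<and> in_local_ideal (swp \<phi>) (swp \<psi>) (\<Sum>k\<le>D. kC (c k) * g k)" by blast
qed

lemma not_colength_le_0:
  assumes "ev2 \<phi> 0 0 = 0" "ev2 \<psi> 0 0 = 0" shows "\<not> colength_le 0 \<phi> \<psi>"
proof
  assume "colength_le 0 \<phi> \<psi>"
  then obtain c where "c (0::nat) \<noteq> 0" "in_local_ideal \<phi> \<psi> (kC (c 0) * 1)"
    unfolding colength_le_def by (drule_tac x = "\<lambda>_. 1" in spec) auto
  then obtain u A B where u: "ev2 u 0 0 \<noteq> 0" and eq: "u * (kC (c 0) * 1) = A * \<phi> + B * \<psi>"
    unfolding in_local_ideal_def in_ideal_def by blast
  have "ev2 (u * (kC (c 0) * 1)) 0 0 = 0" unfolding eq using assms by simp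
  then show False using u \<open>c 0 \<noteq> 0\<close> by simp
qed

text \<open>\<open>F\<close> is obtained from \<open>a\<close> by homogenising it to degree
  \<open>k\<close> in \<open>Y - c X\<close> and \<open>X\<close>, which pull back to
  \<open>x * y\<close> and \<open>x\<close>.\<close>

lemma pull_lift_small_degree:
  assumes "degree a \<le> k" obtains F where "pull c F = vX ^ k * [:a:]"
proof
  define F where "F = (\<Sum>i\<le>k. kC (coeff a i) * (vY - kC c * vX) ^ i * vX ^ (k - i))"
  show "pull c F = vX ^ k * [:a:]"
  proof (rule ev2_ext)
    fix x y
    have "(\<Sum>i\<le>k. coeff a i * (x * (y + c) - c * x) ^ i * x ^ (k - i)) = (\<Sum>i\<le>k. x ^ k * (coeff a i * y ^ i))"
    proof (intro sum.cong refl)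
      fix i assume "i \<in> {..k}"
      then have "x ^ k = x ^ i * x ^ (k - i)" by (simp flip: power_add)
      moreover have "x * (y + c) - c * x = x * y" by (simp add: algebra_simps)
      ultimately show "coeff a i * (x * (y + c) - c * x) ^ i * x ^ (k - i) = x ^ k * (coeff a i * y ^ i)"
        by (simp add: power_mult_distrib)
    qed
    also have "\<dots> = x ^ k * (\<Sum>i\<le>k. coeff a i * y ^ i)" by (simp add: sum_distrib_left)
    also have "(\<Sum>i\<le>k. coeff a i * y ^ i) = poly a y"
      unfolding poly_altdef using assms by (intro sum.mono_neutral_right) (auto simp: coeff_eq_0)
    finally show "ev2 (pull c F) x y = ev2 (vX ^ k * [:a:]) x y"
      by (simp add: F_def ev2_def[of "[:a:]"] del: mult_pCons_right)
  qed
qed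

text \<open>Nakayama's argument: modulo the exceptional line, the strict transform of \<open>\<phi>\<close> has degree
  at most its multiplicity \<open>k\<close>, so every function on the blow-up is congruent to one of the form
  \<open>F / x ^ k\<close>.\<close>

lemma reduce_modulo_strict_transform:
  assumes "\<phi> \<noteq> 0"
  shows "\<exists>F gt w i. pull c F = vX ^ local_mult \<phi> * gt \<and>
    g = gt + i * transform (local_mult \<phi>) (Slope c) \<phi> + vX ^ N * w"
proof (induction N arbitrary: g)
  case 0
  show ?case by (intro exI[of _ 0] exI[of _ g]) simp
next
  case (Suc N)
  define k where "k = local_mult \<phi>"
  define \<phi>' where "\<phi>' = transform k (Slope c) \<phi>"
  define p where "p = coeff \<phi>' 0"
  have pull_phi: "pull c \<phi> = vX ^ k * \<phi>'"
    using blow_up_transform[OF order_at_least_local_mult[of \<phi>], of "Slope c"]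
    by (simp only: \<phi>'_def k_def blow_up_def exc_line_def direction.case)
  then have "coeff (pull c \<phi>) k = p"
    by (simp add: vX_power p_def coeff_monom_mult)
  then have degp: "degree p \<le> k" using degree_coeff_pull by metis
  have "\<not> vX dvd \<phi>'"
    using not_exc_line_dvd_strict[OF assms, of "Slope c"] by (simp only: \<phi>'_def k_def exc_line_def direction.case not_False_eq_True)
  then have "p \<noteq> 0" using vX_power_dvd_iff[of 1 \<phi>'] by (simp add: p_def)
  \<comment> \<open>On the exceptional line \<open>g\<close> is divided by \<open>p\<close>: the
    remainder has degree at most \<open>k\<close> and lifts, the quotient gives a multiple of
    \<open>\<phi>'\<close>, and what is left is divisible by \<open>x\<close>.\<close>
  define a b where "a = coeff g 0 mod p" and "b = coeff g 0 div p"
  have "degree a \<le> k"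
    using degree_mod_less[OF \<open>p \<noteq> 0\<close>, of "coeff g 0"] degp by (auto simp: a_def)
  then obtain F0 where F0: "pull c F0 = vX ^ k * [:a:]" by (rule pull_lift_small_degree)
  have "coeff (g - [:a:] - [:b:] * \<phi>') 0 = 0"
    by (simp add: a_def b_def coeff_mult_0 minus_mod_eq_div_mult flip: p_def)
  then have "vX ^ 1 dvd g - [:a:] - [:b:] * \<phi>'" unfolding vX_power_dvd_iff by simp
  then obtain g1 where g1: "g - [:a:] - [:b:] * \<phi>' = vX * g1" by (metis dvdE power_one_right)
  obtain F gt w i where IH: "pull c F = vX ^ k * gt" "g1 = gt + i * \<phi>' + vX ^ N * w"
    using Suc[of g1] unfolding k_def \<phi>'_def by blast
  have "pull c (F0 + vX * F) = vX ^ k * ([:a:] + vX * gt)"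
    by (simp add: F0 IH(1) distrib_left mult.left_commute del: mult_pCons_right)
  moreover have "g = ([:a:] + vX * gt) + ([:b:] + vX * i) * \<phi>' + vX ^ Suc N * w"
  proof -
    have "g = [:a:] + [:b:] * \<phi>' + vX * g1" using g1 by (simp only: diff_eq_eq diff_diff_eq add_ac)
    then show ?thesis unfolding IH(2)
      by (simp only: distrib_left distrib_right power_Suc mult_ac add_ac)
  qed
  ultimately show ?case unfolding k_def \<phi>'_def by blast
qed

text \<open>Each of \<open>D + 1\<close> functions on the blow-up is replaced, modulo the local
  ideal, by some \<open>F / x ^ k\<close>. The polynomials \<open>F\<close> together with 1 are
  \<open>D + 2\<close> functions downstairs, hence dependent. As every \<open>F\<close> vanishes at
  the origin, 1 has coefficient 0, and dividing the pullback by \<open>x ^ k\<close> gives a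
  relation on the blow-up.\<close>

lemma colength_le_strict_transform_Slope:
  assumes cop: "coprime \<phi> \<psi>" and nz: "\<phi> \<noteq> 0" "\<psi> \<noteq> 0"
    and mult: "1 \<le> local_mult \<phi>" "local_mult \<phi> \<le> local_mult \<psi>"
    and D: "colength_le (Suc D) \<phi> \<psi>"
  shows "colength_le D (transform (local_mult \<phi>) (Slope c) \<phi>) (transform (local_mult \<psi>) (Slope c) \<psi>)"
proof -
  define k l where "k = local_mult \<phi>" and "l = local_mult \<psi>"
  define \<phi>' \<psi>' where "\<phi>' = transform k (Slope c) \<phi>" and "\<psi>' = transform l (Slope c) \<psi>"
  have pull: "pull c \<phi> = vX ^ k * \<phi>'" "pull c \<psi> = vX ^ l * \<psi>'"
    using blow_up_transform[OF order_at_least_local_mult[of \<phi>], of "Slope c"]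
      blow_up_transform[OF order_at_least_local_mult[of \<psi>], of "Slope c"]
    by (simp_all only: \<phi>'_def \<psi>'_def k_def l_def blow_up_def exc_line_def direction.case)
  have "1 \<le> local_mult \<psi>" using mult by simp
  then have zero: "ev2 \<phi> 0 0 = 0" "ev2 \<psi> 0 0 = 0"
    using mult(1) nz by (simp_all flip: order_at_least_1_iff add: order_at_least_iff_le_local_mult)
  have "coprime \<phi>' \<psi>'"
    unfolding \<phi>'_def \<psi>'_def k_def l_def by (rule coprime_strict_transforms[OF cop nz])
  then obtain N where N: "in_local_ideal \<phi>' \<psi>' (vX ^ N)" by (rule in_local_ideal_vX_power)
  have "\<exists>c. (\<exists>j\<le>D. c j \<noteq> 0) \<and> in_local_ideal \<phi>' \<psi>' (\<Sum>j\<le>D. kC (c j) * g j)" for g :: "nat \<Rightarrow> poly2"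
  proof -
    have "\<exists>F gt. pull c F = vX ^ k * gt \<and> in_local_ideal \<phi>' \<psi>' (g j - gt)" for j
    proof -
      obtain F gt w i where *: "pull c F = vX ^ k * gt" "g j = gt + i * \<phi>' + vX ^ N * w"
        using reduce_modulo_strict_transform[OF nz(1), of c "g j" N] unfolding k_def \<phi>'_def by blast
      have "g j - gt = i * \<phi>' + w * vX ^ N" by (simp add: *(2))
      moreover have "in_local_ideal \<phi>' \<psi>' (i * \<phi>' + w * vX ^ N)"
        by (intro in_local_ideal_add in_local_ideal_mult N in_ideal_imp_in_local_ideal in_ideal_generators)
      ultimately have "in_local_ideal \<phi>' \<psi>' (g j - gt)" by simp
      then show ?thesis using *(1) by blast
    qed
    then obtain F gt where F: "\<And>j. pull c (F j) = vX ^ k * gt j" "\<And>j. in_local_ideal \<phi>' \<psi>' (g j - gt j)"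
      by metis
    have F0: "ev2 (F j) 0 0 = 0" for j
    proof -
      have "ev2 (pull c (F j)) 0 0 = 0" unfolding F(1) using mult(1) by (simp add: k_def)
      then show ?thesis by simp
    qed
    define h where "h = case_nat 1 F"
    obtain d u A B where d: "\<exists>j\<le>Suc D. d j \<noteq> 0" and u: "ev2 u 0 0 \<noteq> 0"
      and eq: "u * (\<Sum>j\<le>Suc D. kC (d j) * h j) = A * \<phi> + B * \<psi>"
      using D[unfolded colength_le_def in_local_ideal_def in_ideal_def, rule_format, of h] by blast
    have sum: "(\<Sum>j\<le>Suc D. kC (d j) * h j) = kC (d 0) + (\<Sum>j\<le>D. kC (d (Suc j)) * F j)"
      unfolding sum.atMost_Suc_shift by (simp add: h_def)
    have "ev2 (u * (\<Sum>j\<le>Suc D. kC (d j) * h j)) 0 0 = 0" unfolding eq using zero by simp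
    then have "d 0 = 0" using u unfolding sum by (simp add: F0)
    define e where "e j = d (Suc j)" for j
    have e: "\<exists>j\<le>D. e j \<noteq> 0"
      using d \<open>d 0 = 0\<close> unfolding e_def by (metis Suc_le_mono not0_implies_Suc)
    have "kC (d 0) = 0" by (rule ev2_ext) (simp add: \<open>d 0 = 0\<close>)
    then have eq': "u * (\<Sum>j\<le>D. kC (e j) * F j) = A * \<phi> + B * \<psi>" using eq sum by (simp add: e_def)
    have pull_sum: "pull c (\<Sum>j\<le>D. kC (e j) * F j) = vX ^ k * (\<Sum>j\<le>D. kC (e j) * gt j)"
    proof -
      have "pull c (\<Sum>j\<le>D. kC (e j) * F j) = (\<Sum>j\<le>D. kC (e j) * pull c (F j))"
        by (rule ev2_ext) simp
      then show ?thesis by (simp add: F(1) sum_distrib_left mult.left_commute)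
    qed
    \<comment> \<open>The smaller multiplicity is that of \<open>\<phi>\<close>, so division by
      \<open>x ^ k\<close> leaves a polynomial factor at \<open>\<psi>'\<close>.\<close>
    have lk: "vX ^ l = vX ^ k * vX ^ (l - k)"
      using mult(2) by (simp add: k_def l_def flip: power_add)
    have "pull c u * pull c (\<Sum>j\<le>D. kC (e j) * F j) = pull c A * pull c \<phi> + pull c B * pull c \<psi>"
      using arg_cong[OF eq', of "pull c"] by (simp only: pull_simps)
    then have "vX ^ k * (pull c u * (\<Sum>j\<le>D. kC (e j) * gt j)) =
        vX ^ k * (pull c A * \<phi>' + (pull c B * vX ^ (l - k)) * \<psi>')"
      unfolding pull_sum pull lk by (simp only: distrib_left mult_ac)
    then have "pull c u * (\<Sum>j\<le>D. kC (e j) * gt j) = pull c A * \<phi>' + (pull c B * vX ^ (l - k)) * \<psi>'"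
      by simp
    then have "in_local_ideal \<phi>' \<psi>' (\<Sum>j\<le>D. kC (e j) * gt j)"
      unfolding in_local_ideal_def in_ideal_def using u by (intro exI[of _ "pull c u"]) auto
    moreover have "in_local_ideal \<phi>' \<psi>' (\<Sum>j\<le>D. kC (e j) * (g j - gt j))"
      by (intro in_local_ideal_sum in_local_ideal_mult F(2))
    ultimately have "in_local_ideal \<phi>' \<psi>' ((\<Sum>j\<le>D. kC (e j) * gt j) + (\<Sum>j\<le>D. kC (e j) * (g j - gt j)))"
      by (rule in_local_ideal_add)
    then have "in_local_ideal \<phi>' \<psi>' (\<Sum>j\<le>D. kC (e j) * g j)"
      by (simp add: right_diff_distrib sum_subtractf)
    then show ?thesis using e by blast
  qed
  then show ?thesis unfolding colength_le_def \<phi>'_def \<psi>'_def k_def l_def by blast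
qed

text \<open>Exchanging the curves makes the first multiplicity the smaller one, and exchanging the
  coordinates reduces the vertical direction to slope 0.\<close>

lemma colength_le_strict_transform:
  assumes cop: "coprime \<phi> \<psi>" and nz: "\<phi> \<noteq> 0" "\<psi> \<noteq> 0"
    and mult: "1 \<le> local_mult \<phi>" "1 \<le> local_mult \<psi>" and D: "colength_le (Suc D) \<phi> \<psi>"
  shows "colength_le D (transform (local_mult \<phi>) d \<phi>) (transform (local_mult \<psi>) d \<psi>)"
proof -
  have slope: "colength_le D (transform (local_mult \<phi>) (Slope c) \<phi>) (transform (local_mult \<psi>) (Slope c) \<psi>)"
    if "coprime \<phi> \<psi>" "\<phi> \<noteq> 0" "\<psi> \<noteq> 0" "1 \<le> local_mult \<phi>" "1 \<le> local_mult \<psi>" "colength_le (Suc D) \<phi> \<psi>"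
    for \<phi> \<psi> c
  proof (cases "local_mult \<phi> \<le> local_mult \<psi>")
    case True
    then show ?thesis using that by (intro colength_le_strict_transform_Slope) simp_all
  next
    case False
    have "coprime \<psi> \<phi>" using that(1) by (simp add: coprime_commute)
    then show ?thesis
      using False that colength_le_strict_transform_Slope[of \<psi> \<phi> D c] colength_le_swap by simp
  qed
  show ?thesis
  proof (cases d)
    case (Slope c)
    then show ?thesis using slope[OF assms] by simp
  next
    case Vertical
    have "colength_le D (transform (local_mult (swp \<phi>)) (Slope 0) (swp \<phi>)) (transform (local_mult (swp \<psi>)) (Slope 0) (swp \<psi>))"
      using assms by (intro slope coprime_swp colength_le_swp) simp_all
    from colength_le_swp[OF this] show ?thesis
      unfolding Vertical local_mult_swp transform_Vertical[OF order_at_least_local_mult] .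
  qed
qed

section \<open>Gluing the two charts of a blow-up\<close>

lemma pull_eq_iff: "pull c F = pull c G \<longleftrightarrow> F = G"
  by (metis pull_eq_0_iff pull_simps(4) right_minus_eq)

lemma pull_cX [simp]: "pull c (cX p) = cX p"
  by (rule ev2_ext) simp

lemma pull_transform:
  "order_at_least r F \<Longrightarrow> pull c F = vX ^ r * transform r (Slope c) F"
  using blow_up_transform[of r F "Slope c"] by (simp only: blow_up_def exc_line_def direction.case)

lemma power_add_pred: "1 \<le> b \<Longrightarrow> x ^ (K + b - 1) = x ^ K * x ^ (b - 1)"
  for x :: "'a::monoid_mult"
  by (simp flip: power_add)

text \<open>The functions \<open>u\<close> with \<open>u f / x ^ (\<alpha> + \<beta> - 1)\<close> in the ideal of the strict transforms form an
  ideal without zeros on the exceptional line; it contains a polynomial in \<open>x\<close> alone, from which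
  the power of \<open>x\<close> can be cancelled.\<close>

lemma chart_membership:
  assumes cop: "coprime \<phi> \<psi>"
    and mult: "1 \<le> local_mult \<phi>" "1 \<le> local_mult \<psi>"
    and ord: "order_at_least (local_mult \<phi> + local_mult \<psi> - 1) f"
    and in_local_ideal: "\<And>t. \<exists>u. ev2 u 0 t \<noteq> 0 \<and> in_ideal (transform (local_mult \<phi>) (Slope 0) \<phi>)
      (transform (local_mult \<psi>) (Slope 0) \<psi>) (u * transform (local_mult \<phi> + local_mult \<psi> - 1) (Slope 0) f)"
  shows "\<exists>u K a b. ev2 u 0 0 \<noteq> 0 \<and> order_at_least (K + local_mult \<psi> - 1) a \<and>
    order_at_least (K + local_mult \<phi> - 1) b \<and> u * vX ^ K * f = a * \<phi> + b * \<psi>"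
proof -
  define k l where "k = local_mult \<phi>" and "l = local_mult \<psi>"
  define \<phi>' \<psi>' f' where "\<phi>' = transform k (Slope 0) \<phi>" and "\<psi>' = transform l (Slope 0) \<psi>"
    and "f' = transform (k + l - 1) (Slope 0) f"
  have pull: "pull 0 \<phi> = vX ^ k * \<phi>'" "pull 0 \<psi> = vX ^ l * \<psi>'" "pull 0 f = vX ^ (k + l - 1) * f'"
    unfolding \<phi>'_def \<psi>'_def f'_def k_def l_def
    by (rule pull_transform order_at_least_local_mult ord)+
  have kl: "1 \<le> k" "1 \<le> l" using mult by (simp_all add: k_def l_def)
  define U where "U = {u. in_ideal \<phi>' \<psi>' (u * f')}"
  obtain r where r: "r \<noteq> 0" "in_ideal \<phi> \<psi> (cX r)" using coprime_imp_cX_in_ideal[OF cop] .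
  then obtain A B where "cX r = A * \<phi> + B * \<psi>" unfolding in_ideal_def by blast
  from arg_cong[OF this, of "pull 0"]
  have "cX r = (pull 0 A * vX ^ k) * \<phi>' + (pull 0 B * vX ^ l) * \<psi>'" by (simp add: pull mult.assoc)
  then have "in_ideal \<phi>' \<psi>' (cX r)" unfolding in_ideal_def by blast
  then have rU: "cX r \<in> U" unfolding U_def by (simp add: in_ideal_mult_right)
  obtain M s where s: "r = [:0, 1:] ^ M * s" "poly s 0 \<noteq> 0" using x_power_factor[OF r(1)] .
  have "cX s \<in> U"
  proof (rule ideal_cancel_cX)
    show "u + v \<in> U" if "u \<in> U" "v \<in> U" for u v
      using that by (simp add: U_def distrib_right in_ideal_add)
    show "a * u \<in> U" if "u \<in> U" for a u
      using that by (simp add: U_def mult.assoc in_ideal_mult)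
    show "[:0, 1:] ^ M \<noteq> (0 :: complex poly)" by simp
    show "\<exists>u\<in>U. ev2 u x y \<noteq> 0" if "poly ([:0, 1:] ^ M) x = 0" for x y
      using in_local_ideal[of y] that unfolding U_def \<phi>'_def \<psi>'_def f'_def k_def l_def
      by (auto simp: poly_power)
    show "cX ([:0, 1:] ^ M) * cX s \<in> U" using rU s(1) by simp
  qed
  then obtain A' B' where AB: "cX s * f' = A' * \<phi>' + B' * \<psi>'" unfolding U_def in_ideal_def by blast
  obtain K1 K2 where K: "\<forall>K\<ge>K1. \<exists>F. pull 0 F = vX ^ K * A'" "\<forall>K\<ge>K2. \<exists>F. pull 0 F = vX ^ K * B'"
    using pull_lift by meson
  define K where "K = max K1 K2"
  obtain a0 b0 where a0: "pull 0 a0 = vX ^ K * A'" "pull 0 b0 = vX ^ K * B'"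
    using K[rule_format, of K] unfolding K_def by auto
  \<comment> \<open>The transforms of \<open>f\<close> and \<open>\<phi>\<close> come from division
    by \<open>x ^ (k + l - 1)\<close> and \<open>x ^ k\<close>; the factor
    \<open>x ^ (l - 1)\<close> makes up the difference, and \<open>x ^ (k - 1)\<close> does so for
    \<open>\<psi>\<close>.\<close>
  define a b where "a = vX ^ (l - 1) * a0" and "b = vX ^ (k - 1) * b0"
  have ord_a: "order_at_least (K + l - 1) a" "order_at_least (K + k - 1) b"
    unfolding order_at_least_iff_pull[of _ _ 0] a_def b_def power_add_pred[OF kl(1)] power_add_pred[OF kl(2)]
    by (simp_all add: a0 mult_dvd_mono mult.left_commute)
  have pow: "vX ^ (k + l - 1) = vX ^ (l - 1) * vX ^ k" "vX ^ (k + l - 1) = vX ^ (k - 1) * vX ^ l"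
    using kl by (simp_all add: add.commute flip: power_add)
  have "pull 0 (cX s * vX ^ K * f) = vX ^ K * vX ^ (k + l - 1) * (cX s * f')"
    by (simp add: pull mult_ac)
  also have "\<dots> = vX ^ K * (vX ^ (l - 1) * vX ^ k) * (A' * \<phi>') + vX ^ K * (vX ^ (k - 1) * vX ^ l) * (B' * \<psi>')"
    unfolding AB by (simp only: distrib_left flip: pow)
  also have "\<dots> = pull 0 (a * \<phi> + b * \<psi>)"
    by (simp add: a_def b_def pull a0 mult_ac)
  finally have "cX s * vX ^ K * f = a * \<phi> + b * \<psi>" by (simp only: pull_eq_iff)
  then show ?thesis using s(2) ord_a unfolding k_def l_def
    by (intro exI[of _ "cX s"] exI[of _ K] exI[of _ a] exI[of _ b]) simp
qed

lemma order_at_least_cancel_vX: "order_at_least (K + r) (vX ^ K * F) \<Longrightarrow> order_at_least r F"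
  by (simp add: order_at_least_iff_pull[of _ _ 0] power_add)

lemma order_at_least_cancel_vY: "order_at_least (K + r) (vY ^ K * F) \<Longrightarrow> order_at_least r F"
  using order_at_least_cancel_vX[of K r "swp F"] order_at_least_swp[of "K + r" "vY ^ K * F"] by simp

lemma order_at_least_vX_power: "order_at_least K (vX ^ K)"
  by (simp add: order_at_least_iff_pull[of _ _ 0])

lemma coprime_vX_vY: "coprime (vX ^ m) (vY ^ n)"
proof -
  have "\<not> vX dvd vY ^ n"
    using vX_power_dvd_iff[of 1 "vY ^ n"] by (simp add: vY_power)
  then show ?thesis by (intro coprime_prime_power vX_prime)
qed

text \<open>The relations between two coprime elements are the multiples of the trivial one.\<close>

lemma dvd_of_syzygy:
  fixes \<phi> \<psi> D E :: "'a::{factorial_ring_gcd, semiring_gcd_mult_normalize}"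
  assumes "coprime \<phi> \<psi>" "\<psi> \<noteq> 0" "D * \<phi> + E * \<psi> = 0"
  obtains h where "D = h * \<psi>" "E = - (h * \<phi>)"
proof -
  have *: "D * \<phi> = - E * \<psi>" using assms(3) by (simp add: eq_neg_iff_add_eq_0)
  then have "\<psi> dvd D * \<phi>" by simp
  then have "\<psi> dvd D"
    using assms(1) by (simp add: coprime_commute coprime_dvd_mult_left_iff)
  then obtain h where h: "D = h * \<psi>" by (metis dvdE mult.commute)
  then have "(E + h * \<phi>) * \<psi> = 0" using * by (simp add: algebra_simps)
  then have "E = - (h * \<phi>)" using assms(2) by (simp add: eq_neg_iff_add_eq_0)
  then show thesis using that h by blast
qed

text \<open>A monomial of degree at least \<open>2 K - 1\<close> is divisible by \<open>x ^ K\<close> or by \<open>y ^ K\<close>: this is the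
  vanishing of the first cohomology on the blow-up that makes the two charts glue.\<close>

lemma split_order:
  assumes "order_at_least (K + (K - 1)) h"
  obtains h1 h2 where "h = vY ^ K * h1 + vX ^ K * h2" "order_at_least (K - 1) h1" "order_at_least (K - 1) h2"
proof -
  obtain L H where L: "h = L + vX ^ K * H" "\<forall>i j. cf L i j = (if i < K then cf h i j else 0)"
    using cutoff_decomposition[of h K] by blast
  have "vY ^ K dvd L"
    unfolding vY_power_dvd_iff using L(2) assms by (auto simp: order_at_least_def)
  then obtain h1 where h1: "L = vY ^ K * h1" by (rule dvdE)
  have oL: "order_at_least (K + (K - 1)) L"
    using L(2) assms by (auto simp: order_at_least_def)
  then have "order_at_least (K - 1) h1" unfolding h1 by (rule order_at_least_cancel_vY)
  moreover have "vX ^ K * H = h - L" using L(1) by simp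
  then have "order_at_least (K + (K - 1)) (vX ^ K * H)" using assms oL by (simp only: order_at_least_diff)
  then have "order_at_least (K - 1) H" by (rule order_at_least_cancel_vX)
  ultimately show thesis using that L(1) h1 by blast
qed

text \<open>The two representations, brought to the common multiplier
  \<open>u * x ^ K * y ^ K\<close>, differ by \<open>h\<close> times
  \<open>(\<psi>, - \<phi>)\<close>. The order of \<open>h\<close> is at least
  \<open>2 K - 1\<close>, so \<open>h\<close> splits into one correction for each chart, and the
  corrected representations agree.\<close>

lemma glue_charts:
  assumes cop: "coprime \<phi> \<psi>" and nz: "\<phi> \<noteq> 0" "\<psi> \<noteq> 0" and "1 \<le> K"
    and mult: "1 \<le> local_mult \<phi>" "1 \<le> local_mult \<psi>"
    and 1: "u * vX ^ K * f = a1 * \<phi> + b1 * \<psi>" and 2: "u * vY ^ K * f = a2 * \<phi> + b2 * \<psi>"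
    and oa: "order_at_least (K + local_mult \<psi> - 1) a1" "order_at_least (K + local_mult \<psi> - 1) a2"
    and ob: "order_at_least (K + local_mult \<phi> - 1) b1"
  obtains A B where "u * f = A * \<phi> + B * \<psi>" "order_at_least (local_mult \<psi> - 1) A" "order_at_least (local_mult \<phi> - 1) B"
proof -
  define k l where "k = local_mult \<phi>" and "l = local_mult \<psi>"
  have kl: "1 \<le> k" "1 \<le> l" using mult by (simp_all add: k_def l_def)
  define D E where "D = vY ^ K * a1 - vX ^ K * a2" and "E = vY ^ K * b1 - vX ^ K * b2"
  have "D * \<phi> + E * \<psi> = vY ^ K * (a1 * \<phi> + b1 * \<psi>) - vX ^ K * (a2 * \<phi> + b2 * \<psi>)"
    by (simp add: D_def E_def algebra_simps)
  also have "\<dots> = vY ^ K * (u * vX ^ K * f) - vX ^ K * (u * vY ^ K * f)" by (simp only: 1 2)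
  also have "\<dots> = 0" by (simp add: mult_ac)
  finally obtain h where h: "D = h * \<psi>" "E = - (h * \<phi>)" using dvd_of_syzygy[OF cop nz(2)] by blast
  have oY: "order_at_least K (vY ^ K)"
    using order_at_least_vX_power[of K] order_at_least_swp[of K "vX ^ K"] by simp
  have "order_at_least (K + (K + l - 1)) D" unfolding D_def
    using oa oY order_at_least_vX_power unfolding l_def
    by (intro order_at_least_diff order_at_least_mult)
  then have "order_at_least ((K + (K - 1)) + local_mult \<psi>) (h * \<psi>)"
    using kl \<open>1 \<le> K\<close> by (simp add: h l_def order_at_least_mono)
  then have "order_at_least (K + (K - 1)) h" by (rule order_at_least_cancel) (rule nz)
  then obtain h1 h2 where h12: "h = vY ^ K * h1 + vX ^ K * h2"
    and oh: "order_at_least (K - 1) h1" "order_at_least (K - 1) h2" by (rule split_order)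
  have div: "vX ^ K dvd a" if "vY ^ K * a = vX ^ K * b" for a b
  proof -
    have "vX ^ K dvd vY ^ K * a" using that by simp
    then show ?thesis using coprime_dvd_mult_right_iff[OF coprime_vX_vY, of K K a] by simp
  qed
  \<comment> \<open>The corrected cofactors agree after multiplication by the coprime powers
    \<open>y ^ K\<close> and \<open>x ^ K\<close>, so the first one is divisible by
    \<open>x ^ K\<close>.\<close>
  have "vY ^ K * (a1 - h1 * \<psi>) = vX ^ K * (a2 + h2 * \<psi>)"
    using h(1) unfolding D_def h12 by (simp add: algebra_simps)
  then obtain A where A: "a1 - h1 * \<psi> = vX ^ K * A" using div by (meson dvdE)
  have "vY ^ K * (b1 + h1 * \<phi>) = vX ^ K * (b2 - h2 * \<phi>)"
    using h(2) unfolding E_def h12 by (simp add: algebra_simps)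
  then obtain B where B: "b1 + h1 * \<phi> = vX ^ K * B" using div by (meson dvdE)
  have "vX ^ K * (u * f) = (a1 - h1 * \<psi>) * \<phi> + (b1 + h1 * \<phi>) * \<psi>"
    using 1 by (simp add: algebra_simps)
  also have "\<dots> = vX ^ K * (A * \<phi> + B * \<psi>)" unfolding A B by (simp add: algebra_simps)
  finally have "u * f = A * \<phi> + B * \<psi>" by simp
  moreover have "order_at_least (K + (l - 1)) (vX ^ K * A)"
  proof -
    have "order_at_least ((K - 1) + l) (h1 * \<psi>)"
      unfolding l_def by (intro order_at_least_mult oh order_at_least_local_mult)
    then show ?thesis unfolding A[symmetric]
      using oa(1) kl \<open>1 \<le> K\<close> by (intro order_at_least_diff) (simp_all add: l_def)
  qed
  then have "order_at_least (l - 1) A" by (rule order_at_least_cancel_vX)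
  moreover have "order_at_least (K + (k - 1)) (vX ^ K * B)"
  proof -
    have "order_at_least ((K - 1) + k) (h1 * \<phi>)"
      unfolding k_def by (intro order_at_least_mult oh order_at_least_local_mult)
    then show ?thesis unfolding B[symmetric]
      using ob(1) kl \<open>1 \<le> K\<close> by (intro order_at_least_add) (simp_all add: k_def)
  qed
  then have "order_at_least (k - 1) B" by (rule order_at_least_cancel_vX)
  ultimately show thesis using that by (simp add: k_def l_def)
qed

section \<open>The local theorem\<close>

abbreviation near_mult :: "poly2 \<Rightarrow> direction list \<Rightarrow> nat" where
  "near_mult F ds \<equiv> local_mult (strict_transform F ds)"

lemma local_mult_eq_0_iff: "F \<noteq> 0 \<Longrightarrow> local_mult F = 0 \<longleftrightarrow> ev2 F 0 0 \<noteq> 0"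
  using order_at_least_iff_le_local_mult[of F 1] order_at_least_1_iff[of F] by auto

lemma near_mult_unit:
  assumes "ev2 F 0 0 \<noteq> 0" shows "near_mult F ds = 0"
  using assms
proof (induction ds arbitrary: F rule: rev_induct)
  case Nil
  then have "F \<noteq> 0" by auto
  then show ?case using Nil local_mult_eq_0_iff by simp
next
  case (snoc d ds)
  then have "F \<noteq> 0" by auto
  then have "local_mult F = 0" using snoc.prems local_mult_eq_0_iff by simp
  then have "ev2 (transform (local_mult F) d F) 0 0 \<noteq> 0" using snoc.prems by (simp add: transform_eq)
  then show ?case unfolding strict_transform_append by (rule snoc.IH)
qed

lemma in_local_ideal_if_unit: "ev2 \<phi> 0 0 \<noteq> 0 \<or> ev2 \<psi> 0 0 \<noteq> 0 \<Longrightarrow> in_local_ideal \<phi> \<psi> f"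
  using in_local_idealI[of \<phi> \<phi> \<psi> f] in_local_idealI[of \<psi> \<phi> \<psi> f] by (auto simp: in_ideal_mult_right)

text \<open>Cross-multiplying the two equations gives a relation between \<open>\<phi>\<close> and
  \<open>\<psi>\<close>. Order conditions known for one representation can thus be transferred to
  every other.\<close>

lemma coprime_factors_of_relation:
  fixes \<phi> \<psi> :: "'a::{factorial_ring_gcd, semiring_gcd_mult_normalize}"
  assumes "coprime \<phi> \<psi>" "\<psi> \<noteq> 0" "u * f = A * \<phi> + B * \<psi>" "v * f = A' * \<phi> + B' * \<psi>"
  obtains h where "A' * u = v * A + h * \<psi>" "B' * u = v * B - h * \<phi>"
proof -
  have "(A' * u - v * A) * \<phi> + (B' * u - v * B) * \<psi> = u * (A' * \<phi> + B' * \<psi>) - v * (A * \<phi> + B * \<psi>)"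
    by (simp add: algebra_simps)
  also have "\<dots> = u * (v * f) - v * (u * f)" by (simp only: assms(3,4))
  also have "\<dots> = 0" by (simp add: mult_ac)
  finally obtain h where h: "A' * u - v * A = h * \<psi>" "B' * u - v * B = - (h * \<phi>)"
    using dvd_of_syzygy[OF assms(1,2)] by blast
  have "A' * u = v * A + h * \<psi>" "B' * u = v * B - h * \<phi>"
    using h by (simp_all add: algebra_simps)
  then show thesis using that by blast
qed

lemma order_at_least_cancel_unit:
  assumes "order_at_least r (F * u)" "ev2 u 0 0 \<noteq> 0" shows "order_at_least r F"
proof -
  have "u \<noteq> 0" using assms(2) by auto
  then have "local_mult u = 0" using assms(2) local_mult_eq_0_iff by simp
  then show ?thesis using order_at_least_cancel[of r u F] assms(1) \<open>u \<noteq> 0\<close> by simp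
qed

text \<open>All finite slopes lie in one chart: the origin of the chart for \<open>c\<close> is the
  point \<open>(0, c)\<close> of the chart for slope 0.\<close>

lemma transform_Slope_shift:
  assumes "order_at_least r F"
  shows "transform r (Slope c) F = subst2 (transform r (Slope 0) F) vX (vY + kC c)"
proof (rule transform_unique)
  have "pull c F = subst2 (pull 0 F) vX (vY + kC c)" by (rule ev2_ext) simp
  also have "\<dots> = vX ^ r * subst2 (transform r (Slope 0) F) vX (vY + kC c)"
    unfolding pull_transform[OF assms, of 0] by (rule ev2_ext) (simp del: transform.simps)
  finally show "blow_up (Slope c) F = exc_line (Slope c) ^ r * subst2 (transform r (Slope 0) F) vX (vY + kC c)"
    by (simp only: blow_up_def exc_line_def direction.case)
qed

text \<open>The second chart is the first one after exchanging the coordinates; away from its origin the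
  hypothesis follows from the result in the first chart.\<close>

lemma blow_up_membership:
  assumes cop: "coprime \<phi> \<psi>" and nz: "\<phi> \<noteq> 0" "\<psi> \<noteq> 0"
    and mult: "1 \<le> local_mult \<phi>" "1 \<le> local_mult \<psi>"
    and ord: "order_at_least (local_mult \<phi> + local_mult \<psi> - 1) f"
    and in_local_ideal: "\<And>d. in_local_ideal (transform (local_mult \<phi>) d \<phi>) (transform (local_mult \<psi>) d \<psi>)
      (transform (local_mult \<phi> + local_mult \<psi> - 1) d f)"
  obtains u A B where "ev2 u 0 0 \<noteq> 0" "u * f = A * \<phi> + B * \<psi>"
    "order_at_least (local_mult \<psi> - 1) A" "order_at_least (local_mult \<phi> - 1) B"
proof -
  define k l where "k = local_mult \<phi>" and "l = local_mult \<psi>"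
  note oam = order_at_least_local_mult
  have "\<exists>u. ev2 u 0 t \<noteq> 0 \<and> in_ideal (transform k (Slope 0) \<phi>) (transform l (Slope 0) \<psi>)
      (u * transform (k + l - 1) (Slope 0) f)" for t
  proof -
    obtain u A B where u: "ev2 u 0 0 \<noteq> 0" and eq: "u * transform (k + l - 1) (Slope t) f =
        A * transform k (Slope t) \<phi> + B * transform l (Slope t) \<psi>"
      using in_local_ideal[of "Slope t"] unfolding in_local_ideal_def in_ideal_def k_def l_def by blast
    \<comment> \<open>The translation that moves the origin of the chart for slope \<open>t\<close>
      to the point \<open>(0, t)\<close>.\<close>
    define s where "s F = subst2 F vX (vY - kC t)" for F
    have s: "s (F * G) = s F * s G" "s (F + G) = s F + s G" "s (subst2 F vX (vY + kC t)) = F" for F G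
      by (rule ev2_ext; simp add: s_def)+
    have "s u * transform (k + l - 1) (Slope 0) f =
        s A * transform k (Slope 0) \<phi> + s B * transform l (Slope 0) \<psi>"
      using arg_cong[OF eq, of s] unfolding k_def l_def
        transform_Slope_shift[OF oam, of _ t] transform_Slope_shift[OF ord, of t] s .
    moreover have "ev2 (s u) 0 t \<noteq> 0" using u by (simp add: s_def)
    ultimately show ?thesis unfolding in_ideal_def by blast
  qed
  then obtain u1 K1 a1 b1 where u1: "ev2 u1 0 0 \<noteq> 0" and oa1: "order_at_least (K1 + l - 1) a1"
    and ob1: "order_at_least (K1 + k - 1) b1" and eq1: "u1 * vX ^ K1 * f = a1 * \<phi> + b1 * \<psi>"
    using chart_membership[OF cop mult ord] unfolding k_def l_def by blast
  define \<phi>s \<psi>s fs where "\<phi>s = swp \<phi>" and "\<psi>s = swp \<psi>" and "fs = swp f"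
  define \<phi>t \<psi>t ft where "\<phi>t = transform k (Slope 0) \<phi>s" and "\<psi>t = transform l (Slope 0) \<psi>s"
    and "ft = transform (k + l - 1) (Slope 0) fs"
  have pull: "pull 0 \<phi>s = vX ^ k * \<phi>t" "pull 0 \<psi>s = vX ^ l * \<psi>t" "pull 0 fs = vX ^ (k + l - 1) * ft"
    unfolding \<phi>t_def \<psi>t_def ft_def \<phi>s_def \<psi>s_def fs_def using oam ord
    by (intro pull_transform; simp add: k_def l_def)+
  have kl: "1 \<le> k" "1 \<le> l" using mult by (simp_all add: k_def l_def)
  have "\<exists>u. ev2 u 0 t \<noteq> 0 \<and> in_ideal \<phi>t \<psi>t (u * ft)" for t
  proof (cases "t = 0")
    case True
    have "in_local_ideal (swp \<phi>t) (swp \<psi>t) (swp ft)"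
      using in_local_ideal[of Vertical] unfolding \<phi>t_def \<psi>t_def ft_def \<phi>s_def \<psi>s_def fs_def k_def l_def
        transform_Vertical[OF oam] transform_Vertical[OF ord] .
    then show ?thesis unfolding in_local_ideal_swp using True by (simp add: in_local_ideal_def)
  next
    case False
    \<comment> \<open>For nonzero \<open>t\<close> this is the direction of slope
      \<open>1 / t\<close>, which the first chart covers: the representation found there is
      exchanged and pulled back, and its factor \<open>y ^ K1\<close> does not vanish at
      \<open>(0, t)\<close>.\<close>
    have oas: "order_at_least (K1 + l - 1) (swp a1)" "order_at_least (K1 + k - 1) (swp b1)"
      using oa1 ob1 by simp_all
    define a b where "a = transform (K1 + l - 1) (Slope 0) (swp a1)"
      and "b = transform (K1 + k - 1) (Slope 0) (swp b1)"
    have ab: "pull 0 (swp a1) = vX ^ (K1 + l - 1) * a" "pull 0 (swp b1) = vX ^ (K1 + k - 1) * b"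
      unfolding a_def b_def by (rule pull_transform[OF oas(1)], rule pull_transform[OF oas(2)])
    have pow: "vX ^ (K1 + l - 1) * vX ^ k = vX ^ (K1 + (k + l - 1))"
      "vX ^ (K1 + k - 1) * vX ^ l = vX ^ (K1 + (k + l - 1))"
      using kl by (simp_all add: add_ac flip: power_add)
    have y0: "vY + kC 0 = vY" by (rule ev2_ext) simp
    have "swp u1 * vY ^ K1 * fs = swp a1 * \<phi>s + swp b1 * \<psi>s"
      using arg_cong[OF eq1, of swp] by (simp add: \<phi>s_def \<psi>s_def fs_def)
    from arg_cong[OF this, of "pull 0"]
    have "pull 0 (swp u1) * (vX * vY) ^ K1 * (vX ^ (k + l - 1) * ft) =
        (vX ^ (K1 + l - 1) * a) * (vX ^ k * \<phi>t) + (vX ^ (K1 + k - 1) * b) * (vX ^ l * \<psi>t)"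
      unfolding pull[symmetric] ab[symmetric] by (simp add: y0)
    then have "vX ^ (K1 + (k + l - 1)) * (pull 0 (swp u1) * vY ^ K1 * ft) =
        (vX ^ (K1 + l - 1) * vX ^ k) * (a * \<phi>t) + (vX ^ (K1 + k - 1) * vX ^ l) * (b * \<psi>t)"
      by (simp only: power_mult_distrib power_add mult_ac)
    then have "pull 0 (swp u1) * vY ^ K1 * ft = a * \<phi>t + b * \<psi>t"
      unfolding pow by (simp flip: distrib_left)
    moreover have "ev2 (pull 0 (swp u1) * vY ^ K1) 0 t \<noteq> 0" using u1 False by simp
    ultimately show ?thesis unfolding in_ideal_def by blast
  qed
  then have "\<exists>u K a b. ev2 u 0 0 \<noteq> 0 \<and> order_at_least (K + l - 1) a \<and>
    order_at_least (K + k - 1) b \<and> u * vX ^ K * fs = a * \<phi>s + b * \<psi>s"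
    using chart_membership[of \<phi>s \<psi>s fs] coprime_swp[OF cop] mult ord
    unfolding \<phi>t_def \<psi>t_def ft_def \<phi>s_def \<psi>s_def fs_def k_def l_def by simp
  then obtain u2 K2 a2 b2 where u2: "ev2 u2 0 0 \<noteq> 0" and oa2: "order_at_least (K2 + l - 1) a2"
    and eq2: "u2 * vX ^ K2 * fs = a2 * \<phi>s + b2 * \<psi>s" by blast
  have eq2': "swp u2 * vY ^ K2 * f = swp a2 * \<phi> + swp b2 * \<psi>"
    using arg_cong[OF eq2, of swp] by (simp add: \<phi>s_def \<psi>s_def fs_def)
  \<comment> \<open>A common exponent and a common multiplier for both charts; the summand 1 ensures
    \<open>1 \<le> K\<close>.\<close>
  define K where "K = K1 + K2 + 1"
  define u where "u = u1 * swp u2"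
  have K1: "vX ^ K = vX ^ (K - K1) * vX ^ K1" and K2: "vY ^ K = vY ^ (K - K2) * vY ^ K2"
    by (simp_all add: K_def add_ac flip: power_add)
  have "u * vX ^ K * f = swp u2 * vX ^ (K - K1) * (u1 * vX ^ K1 * f)"
    by (simp only: u_def K1 mult_ac)
  also have "\<dots> = (vX ^ (K - K1) * a1 * swp u2) * \<phi> + (vX ^ (K - K1) * b1 * swp u2) * \<psi>"
    unfolding eq1 by (simp only: distrib_left mult_ac)
  finally have c1: "u * vX ^ K * f = (vX ^ (K - K1) * a1 * swp u2) * \<phi> + (vX ^ (K - K1) * b1 * swp u2) * \<psi>" .
  have "u * vY ^ K * f = u1 * vY ^ (K - K2) * (swp u2 * vY ^ K2 * f)"
    by (simp only: u_def K2 mult_ac)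
  also have "\<dots> = (vY ^ (K - K2) * swp a2 * u1) * \<phi> + (vY ^ (K - K2) * swp b2 * u1) * \<psi>"
    unfolding eq2' by (simp only: distrib_left mult_ac)
  finally have c2: "u * vY ^ K * f = (vY ^ (K - K2) * swp a2 * u1) * \<phi> + (vY ^ (K - K2) * swp b2 * u1) * \<psi>" .
  have o: "order_at_least (K + m - 1) (vX ^ (K - J) * F * w)"
    if "order_at_least (J + m - 1) F" "J \<le> K" "1 \<le> m" for J m F w
  proof -
    have "order_at_least ((K - J) + (J + m - 1) + 0) (vX ^ (K - J) * F * w)"
      using that by (intro order_at_least_mult order_at_least_vX_power) simp_all
    then show ?thesis using that by simp
  qed
  have "order_at_least (K + l - 1) (vX ^ (K - K1) * a1 * swp u2)"
    "order_at_least (K + k - 1) (vX ^ (K - K1) * b1 * swp u2)"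
    using oa1 ob1 kl by (intro o; simp add: K_def)+
  moreover have "order_at_least (K + l - 1) (vY ^ (K - K2) * swp a2 * u1)"
  proof -
    have "order_at_least (K + l - 1) (vX ^ (K - K2) * a2 * swp u1)"
      using oa2 kl by (intro o) (simp_all add: K_def)
    then show ?thesis
      using order_at_least_swp[of "K + l - 1" "vX ^ (K - K2) * a2 * swp u1"] by simp
  qed
  moreover have "1 \<le> K" by (simp add: K_def)
  ultimately obtain A B where "u * f = A * \<phi> + B * \<psi>" "order_at_least (l - 1) A" "order_at_least (k - 1) B"
    using glue_charts[OF cop nz _ mult c1 c2] unfolding k_def l_def by blast
  moreover have "ev2 u 0 0 \<noteq> 0" using u1 u2 by (simp add: u_def)
  ultimately show thesis using that unfolding k_def l_def by blast
qed

text \<open>Induction on a bound for the colength, which drops at every blow-up. The second part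
  speaks of every \<open>v\<close>, \<open>A\<close>, \<open>B\<close> because the induction
  hypothesis is applied to the transforms of a given relation, whose multiplier is a
  pullback.\<close>

theorem local_noether:
  assumes "colength_le D \<phi> \<psi>" "coprime \<phi> \<psi>" "\<phi> \<noteq> 0" "\<psi> \<noteq> 0"
    and "\<And>ds. 1 \<le> near_mult \<phi> ds \<Longrightarrow> 1 \<le> near_mult \<psi> ds \<Longrightarrow>
      order_at_least (near_mult \<phi> ds + near_mult \<psi> ds - 1)
        (virtual_transform (\<lambda>ds. near_mult \<phi> ds + near_mult \<psi> ds - 1) f ds)"
  shows "in_local_ideal \<phi> \<psi> f \<and> (\<forall>v A B ds. v * f = A * \<phi> + B * \<psi> \<longrightarrow> 1 \<le> near_mult \<phi> ds \<longrightarrow> 1 \<le> near_mult \<psi> ds \<longrightarrow>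
    order_at_least (near_mult \<psi> ds - 1) (virtual_transform (\<lambda>ds. near_mult \<psi> ds - 1) A ds) \<and>
    order_at_least (near_mult \<phi> ds - 1) (virtual_transform (\<lambda>ds. near_mult \<phi> ds - 1) B ds))"
  using assms
proof (induction D arbitrary: \<phi> \<psi> f)
  case (0 \<phi> \<psi> f)
  \<comment> \<open>Colength 0 means that one of the curves misses the origin; then the local ideal
    is the unit ideal and there are no common points.\<close>
  then have "ev2 \<phi> 0 0 \<noteq> 0 \<or> ev2 \<psi> 0 0 \<noteq> 0" using not_colength_le_0 by blast
  then show ?case
    by (auto simp: near_mult_unit intro: in_local_ideal_if_unit)
next
  case (Suc D \<phi> \<psi> f)
  note cop = Suc.prems(2) and nz = Suc.prems(3,4)
  show ?case
  proof (cases "ev2 \<phi> 0 0 \<noteq> 0 \<or> ev2 \<psi> 0 0 \<noteq> 0")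
    case True
    then show ?thesis
      by (auto simp: near_mult_unit intro: in_local_ideal_if_unit)
  next
    case False
    define k l where "k = local_mult \<phi>" and "l = local_mult \<psi>"
    have mult: "1 \<le> local_mult \<phi>" "1 \<le> local_mult \<psi>"
      using False nz local_mult_eq_0_iff by (metis less_one not_le)+
    define \<phi>' \<psi>' f' where "\<phi>' d = transform k d \<phi>" and "\<psi>' d = transform l d \<psi>"
      and "f' d = transform (k + l - 1) d f" for d
    have ord: "order_at_least (k + l - 1) f"
      using Suc.prems(5)[of "[]"] mult by (simp add: k_def l_def)
    have near: "near_mult \<phi> (ds @ [d]) = near_mult (\<phi>' d) ds" "near_mult \<psi> (ds @ [d]) = near_mult (\<psi>' d) ds" for d ds
      by (simp_all only: strict_transform_append \<phi>'_def \<psi>'_def k_def l_def)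
    have IH: "in_local_ideal (\<phi>' d) (\<psi>' d) (f' d)"
      "\<And>v A B ds. v * f' d = A * \<phi>' d + B * \<psi>' d \<Longrightarrow> 1 \<le> near_mult (\<phi>' d) ds \<Longrightarrow> 1 \<le> near_mult (\<psi>' d) ds \<Longrightarrow>
        order_at_least (near_mult (\<psi>' d) ds - 1) (virtual_transform (\<lambda>ds. near_mult (\<psi>' d) ds - 1) A ds) \<and>
        order_at_least (near_mult (\<phi>' d) ds - 1) (virtual_transform (\<lambda>ds. near_mult (\<phi>' d) ds - 1) B ds)" for d
    proof -
      have *: "order_at_least (near_mult (\<phi>' d) ds + near_mult (\<psi>' d) ds - 1)
          (virtual_transform (\<lambda>ds. near_mult (\<phi>' d) ds + near_mult (\<psi>' d) ds - 1) (f' d) ds)"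
        if "1 \<le> near_mult (\<phi>' d) ds" "1 \<le> near_mult (\<psi>' d) ds" for ds
        using Suc.prems(5)[of "ds @ [d]"] that
        unfolding virtual_transform_append near f'_def k_def l_def by simp
      have "in_local_ideal (\<phi>' d) (\<psi>' d) (f' d) \<and> (\<forall>v A B ds. v * f' d = A * \<phi>' d + B * \<psi>' d \<longrightarrow> 1 \<le> near_mult (\<phi>' d) ds \<longrightarrow> 1 \<le> near_mult (\<psi>' d) ds \<longrightarrow>
        order_at_least (near_mult (\<psi>' d) ds - 1) (virtual_transform (\<lambda>ds. near_mult (\<psi>' d) ds - 1) A ds) \<and>
        order_at_least (near_mult (\<phi>' d) ds - 1) (virtual_transform (\<lambda>ds. near_mult (\<phi>' d) ds - 1) B ds))"
      proof (rule Suc.IH)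
        show "colength_le D (\<phi>' d) (\<psi>' d)" unfolding \<phi>'_def \<psi>'_def k_def l_def
          by (rule colength_le_strict_transform[OF cop nz mult Suc.prems(1)])
        show "coprime (\<phi>' d) (\<psi>' d)" unfolding \<phi>'_def \<psi>'_def k_def l_def
          by (rule coprime_strict_transforms[OF cop nz])
        show "\<phi>' d \<noteq> 0" "\<psi>' d \<noteq> 0" unfolding \<phi>'_def \<psi>'_def k_def l_def
          by (rule strict_nonzero, rule nz)+
      qed (rule *)
      then show "in_local_ideal (\<phi>' d) (\<psi>' d) (f' d)"
        "\<And>v A B ds. v * f' d = A * \<phi>' d + B * \<psi>' d \<Longrightarrow> 1 \<le> near_mult (\<phi>' d) ds \<Longrightarrow> 1 \<le> near_mult (\<psi>' d) ds \<Longrightarrow>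
        order_at_least (near_mult (\<psi>' d) ds - 1) (virtual_transform (\<lambda>ds. near_mult (\<psi>' d) ds - 1) A ds) \<and>
        order_at_least (near_mult (\<phi>' d) ds - 1) (virtual_transform (\<lambda>ds. near_mult (\<phi>' d) ds - 1) B ds)"
        by blast+
    qed
    obtain u A0 B0 where u: "ev2 u 0 0 \<noteq> 0" "u * f = A0 * \<phi> + B0 * \<psi>"
      "order_at_least (l - 1) A0" "order_at_least (k - 1) B0"
      using blow_up_membership[OF cop nz mult] ord IH(1)
      unfolding k_def l_def \<phi>'_def \<psi>'_def f'_def by metis
    have "in_local_ideal \<phi> \<psi> f" using u(1,2) unfolding in_local_ideal_def in_ideal_def by blast
    moreover have "order_at_least (near_mult \<psi> ds - 1) (virtual_transform (\<lambda>ds. near_mult \<psi> ds - 1) A ds) \<and>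
        order_at_least (near_mult \<phi> ds - 1) (virtual_transform (\<lambda>ds. near_mult \<phi> ds - 1) B ds)"
      if eq: "v * f = A * \<phi> + B * \<psi>" and near1: "1 \<le> near_mult \<phi> ds" "1 \<le> near_mult \<psi> ds" for v A B ds
    proof -
      \<comment> \<open>The given relation is compared with the one from the gluing, which has the
        right orders; the correction terms have at least these orders as well, and \<open>u\<close>
        is a unit of the local ring.\<close>
      obtain h where h: "A * u = v * A0 + h * \<psi>" "B * u = v * B0 - h * \<phi>"
        using coprime_factors_of_relation[OF cop nz(2) u(2) eq] .
      have oh: "order_at_least (l - 1) (h * \<psi>)" "order_at_least (k - 1) (h * \<phi>)"
        using order_at_least_mult[OF order_at_least_0[of h] order_at_least_local_mult[of \<psi>]]
          order_at_least_mult[OF order_at_least_0[of h] order_at_least_local_mult[of \<phi>]]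
        unfolding k_def l_def by (auto elim: order_at_least_mono)
      have ov: "order_at_least (l - 1) (v * A0)" "order_at_least (k - 1) (v * B0)"
        using order_at_least_mult[OF order_at_least_0[of v] u(3)] order_at_least_mult[OF order_at_least_0[of v] u(4)]
        by simp_all
      have "order_at_least (l - 1) (A * u)" unfolding h by (rule order_at_least_add[OF ov(1) oh(1)])
      then have oA: "order_at_least (l - 1) A" using u(1) by (rule order_at_least_cancel_unit)
      have "order_at_least (k - 1) (B * u)" unfolding h by (rule order_at_least_diff[OF ov(2) oh(2)])
      then have oB: "order_at_least (k - 1) B" using u(1) by (rule order_at_least_cancel_unit)
      show ?thesis
      proof (cases ds rule: rev_cases)
        case Nil
        then show ?thesis using oA oB by (simp add: k_def l_def)
      next
        case (snoc ds' d)
        \<comment> \<open>Since \<open>(l - 1) + k\<close> and \<open>(k - 1) + l\<close> both equal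
          \<open>k + l - 1\<close>, the same power of the exceptional line cancels in all terms of
          the pulled back relation.\<close>
        define A' B' where "A' = transform (l - 1) d A" and "B' = transform (k - 1) d B"
        have blow_up_eqs: "blow_up d A = exc_line d ^ (l - 1) * A'" "blow_up d B = exc_line d ^ (k - 1) * B'"
          "blow_up d \<phi> = exc_line d ^ k * \<phi>' d" "blow_up d \<psi> = exc_line d ^ l * \<psi>' d" "blow_up d f = exc_line d ^ (k + l - 1) * f' d"
          unfolding A'_def B'_def \<phi>'_def \<psi>'_def f'_def k_def l_def
          by (rule blow_up_transform order_at_least_local_mult
              oA[unfolded l_def] oB[unfolded k_def] ord[unfolded k_def l_def])+
        have pow: "exc_line d ^ (l - 1) * exc_line d ^ k = exc_line d ^ (k + l - 1)" "exc_line d ^ (k - 1) * exc_line d ^ l = exc_line d ^ (k + l - 1)"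
          using mult by (simp_all add: k_def l_def add.commute flip: power_add)
        have "exc_line d ^ (k + l - 1) * (blow_up d v * f' d) = blow_up d (v * f)" by (simp add: blow_up_eqs mult_ac)
        also have "\<dots> = (exc_line d ^ (l - 1) * exc_line d ^ k) * (A' * \<phi>' d) + (exc_line d ^ (k - 1) * exc_line d ^ l) * (B' * \<psi>' d)"
          unfolding eq by (simp add: blow_up_eqs mult_ac)
        finally have "blow_up d v * f' d = A' * \<phi>' d + B' * \<psi>' d"
          unfolding pow by (simp flip: distrib_left)
        from IH(2)[OF this, of ds'] near1 show ?thesis
          unfolding snoc near virtual_transform_append A'_def B'_def k_def l_def by simp
      qed
    qed
    ultimately show ?thesis by blast
  qed
qed

section \<open>Homogeneous polynomials and affine charts\<close>

definition hX :: poly3 where "hX = [:0, 1:]"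
definition hY :: poly3 where "hY = [:vX:]"
definition hZ :: poly3 where "hZ = [:vY:]"
definition hC :: "complex \<Rightarrow> poly3" where "hC a = [:kC a:]"

lemma ev3_vars [simp]:
  "ev3 hX a b c = a" "ev3 hY a b c = b" "ev3 hZ a b c = c" "ev3 (hC s) a b c = s"
  by (simp_all add: ev3_def hX_def hY_def hZ_def hC_def vX_def vY_def kC_def)

lemma ev3_sum [simp]: "ev3 (sum f S) a b c = (\<Sum>i\<in>S. ev3 (f i) a b c)"
  by (induction S rule: infinite_finite_induct) auto

abbreviation cf3 :: "poly3 \<Rightarrow> nat \<Rightarrow> nat \<Rightarrow> nat \<Rightarrow> complex" where
  "cf3 F i j k \<equiv> coeff (coeff (coeff F i) j) k"

lemma poly3_eqI: "(\<And>i j k. cf3 F i j k = cf3 G i j k) \<Longrightarrow> F = G"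
  by (intro poly_eqI)

lemma cf3_mult:
  "cf3 (F * G) i j k = (\<Sum>a\<le>i. \<Sum>b\<le>j. \<Sum>c\<le>k. cf3 F a b c * cf3 G (i - a) (j - b) (k - c))"
  by (simp add: coeff_mult coeff_sum)

lemma homogeneousD: "homogeneous d F \<Longrightarrow> int (i + j + k) \<noteq> d \<Longrightarrow> cf3 F i j k = 0"
  unfolding homogeneous_def by blast

lemma homogeneous_zero [simp]: "homogeneous d 0"
  by (simp add: homogeneous_def)

lemma homogeneous_add: "homogeneous d F \<Longrightarrow> homogeneous d G \<Longrightarrow> homogeneous d (F + G)"
  unfolding homogeneous_def by (metis add.right_neutral add_0 coeff_add)

lemma homogeneous_diff: "homogeneous d F \<Longrightarrow> homogeneous d G \<Longrightarrow> homogeneous d (F - G)"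
  unfolding homogeneous_def by (metis coeff_diff diff_zero)

lemma homogeneous_mult:
  assumes "homogeneous d F" "homogeneous e G" shows "homogeneous (d + e) (F * G)"
  unfolding homogeneous_def
proof (intro allI impI)
  fix i j k assume "cf3 (F * G) i j k \<noteq> 0"
  then obtain a b c where *: "a \<le> i" "b \<le> j" "c \<le> k" "cf3 F a b c * cf3 G (i - a) (j - b) (k - c) \<noteq> 0"
    unfolding cf3_mult by (metis (no_types, lifting) atMost_iff sum.neutral)
  then have "cf3 F a b c \<noteq> 0" "cf3 G (i - a) (j - b) (k - c) \<noteq> 0" by auto
  then have "int (a + b + c) = d" "int ((i - a) + (j - b) + (k - c)) = e"
    using assms unfolding homogeneous_def by blast+
  then show "int (i + j + k) = d + e" using * by auto
qed

lemma homogeneous_vars: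
  "homogeneous 1 hX" "homogeneous 1 hY" "homogeneous 1 hZ" "homogeneous 0 (hC a)" "homogeneous 0 1"
  by (auto simp: homogeneous_def hX_def hY_def hZ_def hC_def vX_def vY_def kC_def coeff_pCons
      split: nat.splits)

lemma homogeneous_power: "homogeneous 1 F \<Longrightarrow> homogeneous (int n) (F ^ n)"
proof (induction n)
  case (Suc n)
  then have "homogeneous (1 + int n) (F * F ^ n)" by (intro homogeneous_mult) simp_all
  then show ?case by simp
qed (simp add: homogeneous_vars)

lemma homogeneous_mult_nat:
  "homogeneous (int m) F \<Longrightarrow> homogeneous (int n) G \<Longrightarrow> homogeneous (int (m + n)) (F * G)"
  using homogeneous_mult by simp

lemma ev3_homogeneous:
  assumes "homogeneous (int n) F"
  shows "ev3 F (t * a) (t * b) (t * c) = t ^ n * ev3 F a b c"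
  unfolding ev3_expand sum_distrib_left
proof (intro sum.cong refl)
  fix i j k
  show "cf3 F i j k * (t * a) ^ i * (t * b) ^ j * (t * c) ^ k = t ^ n * (cf3 F i j k * a ^ i * b ^ j * c ^ k)"
  proof (cases "i + j + k = n")
    case True
    then show ?thesis by (auto simp: power_mult_distrib power_add)
  next
    case False
    then have "cf3 F i j k = 0" using homogeneousD[OF assms] by simp
    then show ?thesis by simp
  qed
qed

text \<open>An affine chart of the plane: the point with affine coordinates \<open>x, y\<close> has homogeneous
  coordinates \<open>m1, m2, m3\<close>, and conversely \<open>x = l1 / l3\<close> and \<open>y = l2 / l3\<close>.\<close>

locale affine_chart =
  fixes m1 m2 m3 :: poly2 and l1 l2 l3 :: poly3
  assumes homog: "homogeneous 1 l1" "homogeneous 1 l2" "homogeneous 1 l3"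
    and l3_nonzero: "l3 \<noteq> 0"
    and subst_l: "subst3 l1 m1 m2 m3 = vX" "subst3 l2 m1 m2 m3 = vY" "subst3 l3 m1 m2 m3 = 1"
    and point: "\<And>a b c. ev3 l3 a b c \<noteq> 0 \<Longrightarrow> \<exists>x y. a = ev3 l3 a b c * ev2 m1 x y \<and>
      b = ev3 l3 a b c * ev2 m2 x y \<and> c = ev3 l3 a b c * ev2 m3 x y"
begin

definition res :: "poly3 \<Rightarrow> poly2" where "res F = subst3 F m1 m2 m3"

lemma ev2_res [simp]: "ev2 (res F) x y = ev3 F (ev2 m1 x y) (ev2 m2 x y) (ev2 m3 x y)"
  by (simp add: res_def)

lemma res_simps [simp]:
  "res 0 = 0" "res 1 = 1" "res (F + G) = res F + res G" "res (F - G) = res F - res G"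
  "res (F * G) = res F * res G" "res (F ^ n) = res F ^ n" "res (hC a) = kC a"
  by (rule ev2_ext; simp)+

lemma res_l [simp]: "res l1 = vX" "res l2 = vY" "res l3 = 1"
  using subst_l by (simp_all add: res_def)

text \<open>By homogeneity \<open>G\<close> vanishes wherever \<open>l3\<close> does not, so
  \<open>G * l3\<close> vanishes identically.\<close>

lemma res_eq_0:
  assumes "homogeneous (int n) G" "res G = 0" shows "G = 0"
proof -
  have "G * l3 = 0"
  proof (rule ev3_ext)
    fix a b c
    define t where "t = ev3 l3 a b c"
    have "ev3 G a b c = 0" if t: "t \<noteq> 0"
    proof -
      obtain x y where "a = t * ev2 m1 x y" "b = t * ev2 m2 x y" "c = t * ev2 m3 x y"
        using point[of a b c] t unfolding t_def by blast
      then have "ev3 G a b c = t ^ n * ev2 (res G) x y"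
        by (simp only: ev3_homogeneous[OF assms(1)] ev2_res)
      then show ?thesis using assms(2) by simp
    qed
    then show "ev3 (G * l3) a b c = ev3 0 a b c" by (auto simp: t_def)
  qed
  then show ?thesis using l3_nonzero by simp
qed

lemma res_inj:
  assumes "homogeneous (int n) F" "homogeneous (int n) G" "res F = res G" shows "F = G"
  using res_eq_0[OF homogeneous_diff[OF assms(1,2)]] assms(3) by simp

text \<open>Homogenisation by means of \<open>l3\<close>, which restricts to 1. Every large degree
  is possible, so that the terms of a sum can be given the same degree.\<close>

lemma res_lift: "\<exists>N0. \<forall>N\<ge>N0. \<exists>G. homogeneous (int N) G \<and> res G = g"
proof (induction g rule: poly2_induct)
  case (const a)
  have "homogeneous (0 + int N) (hC a * l3 ^ N)" for N
    by (intro homogeneous_mult homogeneous_vars homogeneous_power homog)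
  then have "homogeneous (int N) (hC a * l3 ^ N) \<and> res (hC a * l3 ^ N) = kC a" for N
    by simp
  then show ?case by blast
next
  case (add g h)
  then obtain N1 N2 where "\<forall>N\<ge>N1. \<exists>G. homogeneous (int N) G \<and> res G = g"
    "\<forall>N\<ge>N2. \<exists>G. homogeneous (int N) G \<and> res G = h" by blast
  then have "\<forall>N\<ge>max N1 N2. \<exists>G. homogeneous (int N) G \<and> res G = g + h"
    by (metis homogeneous_add max.bounded_iff res_simps(3))
  then show ?case by blast
next
  case (multX g)
  then obtain N1 where N1: "\<forall>N\<ge>N1. \<exists>G. homogeneous (int N) G \<and> res G = g" by blast
  have "\<exists>G. homogeneous (int N) G \<and> res G = vX * g" if "N \<ge> Suc N1" for N
  proof -
    obtain M where M: "N = Suc M" "M \<ge> N1" using \<open>N \<ge> Suc N1\<close> by (cases N) auto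
    then obtain G where "homogeneous (int M) G" "res G = g" using N1 by blast
    then show ?thesis using homogeneous_mult[OF homog(1), of "int M" G] M(1)
      by (intro exI[of _ "l1 * G"]) simp
  qed
  then show ?case by blast
next
  case (multY g)
  then obtain N1 where N1: "\<forall>N\<ge>N1. \<exists>G. homogeneous (int N) G \<and> res G = g" by blast
  have "\<exists>G. homogeneous (int N) G \<and> res G = vY * g" if "N \<ge> Suc N1" for N
  proof -
    obtain M where M: "N = Suc M" "M \<ge> N1" using \<open>N \<ge> Suc N1\<close> by (cases N) auto
    then obtain G where "homogeneous (int M) G" "res G = g" using N1 by blast
    then show ?thesis using homogeneous_mult[OF homog(2), of "int M" G] M(1)
      by (intro exI[of _ "l2 * G"]) simp
  qed
  then show ?case by blast
qed

text \<open>As for strict transforms, a common factor \<open>g\<close> homogenises to some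
  \<open>G\<close> that divides a power of \<open>l3\<close>; restricting to the chart makes
  \<open>g\<close> a unit.\<close>

lemma coprime_res:
  assumes "coprime \<phi> \<psi>" and "homogeneous (int p) \<phi>" "homogeneous (int q) \<psi>"
  shows "coprime (res \<phi>) (res \<psi>)"
proof (rule coprimeI)
  fix g assume g: "g dvd res \<phi>" "g dvd res \<psi>"
  obtain N G where G: "homogeneous (int N) G" "res G = g" using res_lift[of g] by blast
  have *: "\<exists>M. \<forall>m\<ge>M. G dvd l3 ^ m * F" if gF: "g dvd res F" and F: "homogeneous (int r) F" for F r
  proof -
    obtain e where e: "res F = g * e" using gF by (rule dvdE)
    obtain L where L: "\<forall>M\<ge>L. \<exists>E. homogeneous (int M) E \<and> res E = e" using res_lift[of e] by blast
    have "G dvd l3 ^ m * F" if "m \<ge> L + N" for m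
    proof -
      have "m + r - N \<ge> L" using that by simp
      then obtain E where E: "homogeneous (int (m + r - N)) E" "res E = e" using L by blast
      have "homogeneous (int (m + r)) (G * E)"
        using homogeneous_mult_nat[OF G(1) E(1)] that by simp
      moreover have "homogeneous (int (m + r)) (l3 ^ m * F)"
        using homogeneous_mult_nat[OF homogeneous_power[OF homog(3)] F] .
      moreover have "res (G * E) = res (l3 ^ m * F)" by (simp add: G E e)
      ultimately have "G * E = l3 ^ m * F" by (rule res_inj)
      then show ?thesis by (metis dvd_triv_left)
    qed
    then show ?thesis by blast
  qed
  obtain M1 M2 where "\<forall>m\<ge>M1. G dvd l3 ^ m * \<phi>" "\<forall>m\<ge>M2. G dvd l3 ^ m * \<psi>"
    using *[OF g(1) assms(2)] *[OF g(2) assms(3)] by blast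
  then have "G dvd l3 ^ max M1 M2"
    by - (rule coprime_common_dvd_multiple[OF assms(1)]; simp)
  then obtain H where "l3 ^ max M1 M2 = G * H" by (rule dvdE)
  from arg_cong[OF this, of res] show "is_unit g" by (simp add: G dvdI)
qed

text \<open>All terms of the relation are homogenised to one degree \<open>T\<close>, where a
  polynomial is determined by its restriction.\<close>

lemma in_ideal_res_lift:
  assumes "homogeneous (int p) \<phi>" "homogeneous (int q) \<psi>" "homogeneous (int n) f"
    and "in_ideal (res \<phi>) (res \<psi>) (u * res f)"
  obtains N U where "homogeneous (int N) U" "res U = u" "in_ideal \<phi> \<psi> (U * f)"
proof -
  obtain a b where ab: "u * res f = a * res \<phi> + b * res \<psi>" using assms(4) unfolding in_ideal_def by blast
  obtain Na Nb Nu where N: "\<forall>N\<ge>Na. \<exists>G. homogeneous (int N) G \<and> res G = a"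
    "\<forall>N\<ge>Nb. \<exists>G. homogeneous (int N) G \<and> res G = b"
    "\<forall>N\<ge>Nu. \<exists>G. homogeneous (int N) G \<and> res G = u"
    using res_lift[of a] res_lift[of b] res_lift[of u] by blast
  define T where "T = Na + Nb + Nu + n + p + q"
  have "Na \<le> T - p" "Nb \<le> T - q" "Nu \<le> T - n" by (simp_all add: T_def)
  then obtain A B U where A: "homogeneous (int (T - p)) A" "res A = a"
    and B: "homogeneous (int (T - q)) B" "res B = b" and U: "homogeneous (int (T - n)) U" "res U = u"
    using N by blast
  have T: "T - p + p = T" "T - q + q = T" "T - n + n = T" by (simp_all add: T_def)
  have "homogeneous (int T) (A * \<phi>)" "homogeneous (int T) (B * \<psi>)" "homogeneous (int T) (U * f)"
    using homogeneous_mult_nat[OF A(1) assms(1)] homogeneous_mult_nat[OF B(1) assms(2)]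
      homogeneous_mult_nat[OF U(1) assms(3)] unfolding T by blast+
  then have "U * f = A * \<phi> + B * \<psi>"
    by (intro res_inj[of T] homogeneous_add) (simp_all add: A B U ab)
  then show thesis using that U unfolding in_ideal_def by blast
qed

text \<open>The multipliers \<open>u\<close> of the restricted problem form an ideal without zeros
  in the chart, so it contains 1, and a homogenisation of 1 is a power of \<open>l3\<close>.\<close>

lemma power_in_ideal:
  assumes "coprime \<phi> \<psi>" and h: "homogeneous (int p) \<phi>" "homogeneous (int q) \<psi>" "homogeneous (int n) f"
    and in_local_ideal: "\<And>a b c. (a, b, c) \<noteq> (0, 0, 0) \<Longrightarrow> \<exists>U. ev3 U a b c \<noteq> 0 \<and> in_ideal \<phi> \<psi> (U * f)"
  obtains K where "in_ideal \<phi> \<psi> (l3 ^ K * f)"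
proof -
  define V where "V = {u. in_ideal (res \<phi>) (res \<psi>) (u * res f)}"
  obtain r where r: "r \<noteq> 0" "in_ideal (res \<phi>) (res \<psi>) (cX r)"
    using coprime_imp_cX_in_ideal[OF coprime_res[OF assms(1) h(1,2)]] .
  have "1 \<in> V"
  proof (rule ideal_cancel_cX)
    show "u + v \<in> V" if "u \<in> V" "v \<in> V" for u v
      using that by (simp add: V_def distrib_right in_ideal_add)
    show "a * u \<in> V" if "u \<in> V" for a u
      using that by (simp add: V_def mult.assoc in_ideal_mult)
    show "r \<noteq> 0" by (rule r)
    show "cX r * 1 \<in> V" using r(2) by (simp add: V_def in_ideal_mult_right)
    fix x y
    have "ev3 l3 (ev2 m1 x y) (ev2 m2 x y) (ev2 m3 x y) = ev2 (res l3) x y" by (simp only: ev2_res)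
    then have "ev3 l3 (ev2 m1 x y) (ev2 m2 x y) (ev2 m3 x y) = 1" by simp
    moreover have "ev3 l3 0 0 0 = 0" using ev3_homogeneous[of 1 l3 0 0 0 0] homog(3) by simp
    ultimately have "(ev2 m1 x y, ev2 m2 x y, ev2 m3 x y) \<noteq> (0, 0, 0)" by auto
    then obtain U where U: "ev3 U (ev2 m1 x y) (ev2 m2 x y) (ev2 m3 x y) \<noteq> 0" "in_ideal \<phi> \<psi> (U * f)"
      using in_local_ideal by blast
    then obtain A B where "U * f = A * \<phi> + B * \<psi>" unfolding in_ideal_def by blast
    from arg_cong[OF this, of res] have "res U \<in> V" unfolding V_def in_ideal_def by auto
    then show "\<exists>u\<in>V. ev2 u x y \<noteq> 0" using U(1) by (intro bexI[of _ "res U"]) simp_all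
  qed
  then have "in_ideal (res \<phi>) (res \<psi>) (1 * res f)" unfolding V_def by blast
  then obtain N U where U: "homogeneous (int N) U" "res U = 1" "in_ideal \<phi> \<psi> (U * f)"
    using in_ideal_res_lift[OF h] by blast
  have "U = l3 ^ N" using U by (intro res_inj[of N] homogeneous_power homog) simp_all
  then show thesis using that U(3) by blast
qed

end

lemma affine_chart_Z: "affine_chart (kC a + vX) (kC b + vY) 1 (hX - hC a * hZ) (hY - hC b * hZ) hZ"
proof
  show "homogeneous 1 (hX - hC a * hZ)" "homogeneous 1 (hY - hC b * hZ)" "homogeneous 1 hZ"
    using homogeneous_mult[OF homogeneous_vars(4) homogeneous_vars(3)]
    by (auto intro!: homogeneous_diff homogeneous_vars)
  show "hZ \<noteq> 0" by (simp add: hZ_def)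
  show "subst3 (hX - hC a * hZ) (kC a + vX) (kC b + vY) 1 = vX"
    "subst3 (hY - hC b * hZ) (kC a + vX) (kC b + vY) 1 = vY"
    "subst3 hZ (kC a + vX) (kC b + vY) 1 = 1"
    by (rule ev2_ext; simp)+
  fix r s t assume "ev3 hZ r s t \<noteq> 0"
  then show "\<exists>x y. r = ev3 hZ r s t * ev2 (kC a + vX) x y \<and>
      s = ev3 hZ r s t * ev2 (kC b + vY) x y \<and> t = ev3 hZ r s t * ev2 1 x y"
    by (intro exI[of _ "r / t - a"] exI[of _ "s / t - b"]) simp
qed

lemma affine_chart_Y: "affine_chart (kC a + vX) 1 vY (hX - hC a * hY) hZ hY"
proof
  show "homogeneous 1 (hX - hC a * hY)" "homogeneous 1 hZ" "homogeneous 1 hY"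
    using homogeneous_mult[OF homogeneous_vars(4) homogeneous_vars(2)]
    by (auto intro!: homogeneous_diff homogeneous_vars)
  show "hY \<noteq> 0" by (simp add: hY_def)
  show "subst3 (hX - hC a * hY) (kC a + vX) 1 vY = vX"
    "subst3 hZ (kC a + vX) 1 vY = vY" "subst3 hY (kC a + vX) 1 vY = 1"
    by (rule ev2_ext; simp)+
  fix r s t assume "ev3 hY r s t \<noteq> 0"
  then show "\<exists>x y. r = ev3 hY r s t * ev2 (kC a + vX) x y \<and>
      s = ev3 hY r s t * ev2 1 x y \<and> t = ev3 hY r s t * ev2 vY x y"
    by (intro exI[of _ "r / s - a"] exI[of _ "t / s"]) simp
qed

lemma affine_chart_X: "affine_chart 1 vX vY hY hZ hX"
proof
  show "homogeneous 1 hY" "homogeneous 1 hZ" "homogeneous 1 hX" by (rule homogeneous_vars)+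
  show "hX \<noteq> 0" by (simp add: hX_def)
  show "subst3 hY 1 vX vY = vX" "subst3 hZ 1 vX vY = vY" "subst3 hX 1 vX vY = 1"
    by (rule ev2_ext; simp)+
  fix r s t assume "ev3 hX r s t \<noteq> 0"
  then show "\<exists>x y. r = ev3 hX r s t * ev2 1 x y \<and>
      s = ev3 hX r s t * ev2 vX x y \<and> t = ev3 hX r s t * ev2 vY x y"
    by (intro exI[of _ "s / r"] exI[of _ "t / r"]) simp
qed

text \<open>The factor \<open>s\<close> relates the given coordinates of the point to those of the
  origin of the chart; by homogeneity it carries non-vanishing from one to the other.\<close>

lemma local_eq_chart:
  assumes "(a, b, c) \<noteq> (0, 0, 0)"
  obtains m1 m2 m3 l1 l2 l3 s where "affine_chart m1 m2 m3 l1 l2 l3"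
    "\<And>F. local_eq F (a, b, c) = subst3 F m1 m2 m3"
    "s \<noteq> 0" "a = s * ev2 m1 0 0" "b = s * ev2 m2 0 0" "c = s * ev2 m3 0 0"
proof -
  consider (Z) "c \<noteq> 0" | (Y) "c = 0" "b \<noteq> 0" | (X) "c = 0" "b = 0" "a \<noteq> 0" using assms by auto
  then show thesis
  proof cases
    case Z
    then show thesis
      by (intro that[of _ _ _ _ _ _ c, OF affine_chart_Z[of "a / c" "b / c"]])
        (simp_all add: vX_def vY_def kC_def ev2_def)
  next
    case Y
    then show thesis
      by (intro that[of _ _ _ _ _ _ b, OF affine_chart_Y[of "a / b"]])
        (simp_all add: vX_def vY_def kC_def ev2_def)
  next
    case X
    then show thesis
      by (intro that[of _ _ _ _ _ _ a, OF affine_chart_X])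
        (simp_all add: vX_def vY_def kC_def ev2_def)
  qed
qed

section \<open>The global theorem\<close>

lemma hX_power: "hX ^ K = monom 1 K"
  by (simp add: hX_def monom_altdef)

lemma hX_power_dvd_iff: "hX ^ K dvd F \<longleftrightarrow> (\<forall>i<K. coeff F i = 0)"
  by (simp add: hX_power monom_1_dvd_iff')

lemma hX_nonzero [simp]: "hX \<noteq> 0" by (simp add: hX_def)

lemma hY_power: "hY ^ K = [:vX ^ K:]" and hZ_power: "hZ ^ K = [:vY ^ K:]"
  by (simp_all add: hY_def hZ_def poly_const_pow)

lemma hX_power_dvd_cancel: "hX ^ K dvd hY ^ K * F \<Longrightarrow> hX ^ K dvd F"
  by (simp add: hX_power_dvd_iff hY_power)

text \<open>This says that \<open>hZ ^ K\<close> is not a zero divisor modulo \<open>hX ^ K\<close>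
  and \<open>hY ^ K\<close>. The part of \<open>h\<close> of degree below \<open>K\<close> in
  \<open>hX\<close> is treated coefficient by coefficient.\<close>

lemma cancel_hZ_modulo_hX_hY:
  assumes "hZ ^ K * h = hX ^ K * a + hY ^ K * b"
  obtains g1 g2 where "h = hY ^ K * g1 + hX ^ K * g2"
proof -
  define L where "L = (\<Sum>i<K. monom (coeff h i) i)"
  have L: "coeff L i = (if i < K then coeff h i else 0)" for i
    by (simp add: L_def coeff_sum)
  have "hX ^ K dvd h - L" by (simp add: hX_power_dvd_iff L)
  then obtain g2 where g2: "h - L = hX ^ K * g2" by (rule dvdE)
  \<comment> \<open>The coefficients with respect to \<open>hX\<close> are polynomials in the other
    two variables, where \<open>hY\<close> and \<open>hZ\<close> appear as \<open>vX\<close> and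
    \<open>vY\<close>.\<close>
  have "vX ^ K dvd coeff L i" for i
  proof (cases "i < K")
    case True
    have "coeff (hX ^ K * a) i = 0"
      using True hX_power_dvd_iff[of K "hX ^ K * a"] by simp
    then have "vY ^ K * coeff h i = vX ^ K * coeff b i"
      using arg_cong[OF assms, of "\<lambda>F. coeff F i"] by (simp add: hY_power hZ_power)
    then have "vX ^ K dvd vY ^ K * coeff h i" by simp
    then have "vX ^ K dvd coeff h i"
      using coprime_dvd_mult_right_iff[OF coprime_vX_vY, of K K "coeff h i"] by simp
    then show ?thesis using True by (simp add: L)
  next
    case False
    then show ?thesis by (simp add: L)
  qed
  then have "hY ^ K dvd L" by (simp add: hY_power const_poly_dvd_iff)
  then obtain g1 where "L = hY ^ K * g1" by (rule dvdE)
  then have "h = hY ^ K * g1 + hX ^ K * g2" using g2 by (simp only: diff_eq_eq add.commute)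
  then show thesis by (rule that)
qed

text \<open>The powers of the three variables form a regular sequence, so the discrepancies between the
  three representations of \<open>f\<close> satisfy a Koszul relation and can be removed.\<close>

lemma in_ideal_if_powers_in_ideal:
  assumes cop: "coprime \<phi> \<psi>" and nz: "\<psi> \<noteq> 0"
    and in_ideal: "in_ideal \<phi> \<psi> (hX ^ K * f)" "in_ideal \<phi> \<psi> (hY ^ K * f)" "in_ideal \<phi> \<psi> (hZ ^ K * f)"
  shows "in_ideal \<phi> \<psi> f"
proof -
  obtain a1 b1 where 1: "hX ^ K * f = a1 * \<phi> + b1 * \<psi>" using in_ideal(1) unfolding in_ideal_def by blast
  obtain a2 b2 where 2: "hY ^ K * f = a2 * \<phi> + b2 * \<psi>" using in_ideal(2) unfolding in_ideal_def by blast
  obtain a3 b3 where 3: "hZ ^ K * f = a3 * \<phi> + b3 * \<psi>" using in_ideal(3) unfolding in_ideal_def by blast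
  have rel: "\<exists>h. s * a - r * b = h * \<psi> \<and> s * a' - r * b' = - (h * \<phi>)"
    if "r * f = a * \<phi> + a' * \<psi>" "s * f = b * \<phi> + b' * \<psi>" for r s a a' b b'
  proof -
    have "(s * a - r * b) * \<phi> + (s * a' - r * b') * \<psi> = s * (a * \<phi> + a' * \<psi>) - r * (b * \<phi> + b' * \<psi>)"
      by (simp add: algebra_simps)
    also have "\<dots> = s * (r * f) - r * (s * f)" by (simp only: that)
    also have "\<dots> = 0" by (simp add: mult_ac)
    finally show ?thesis using dvd_of_syzygy[OF cop nz] by metis
  qed
  obtain h12 where h12: "hY ^ K * a1 - hX ^ K * a2 = h12 * \<psi>" "hY ^ K * b1 - hX ^ K * b2 = - (h12 * \<phi>)"
    using rel[OF 1 2] by blast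
  obtain h13 where h13: "hZ ^ K * a1 - hX ^ K * a3 = h13 * \<psi>" using rel[OF 1 3] by blast
  obtain h23 where h23: "hZ ^ K * a2 - hY ^ K * a3 = h23 * \<psi>" using rel[OF 2 3] by blast
  have "hZ ^ K * (h12 * \<psi>) = hX ^ K * (- (h23 * \<psi>)) + hY ^ K * (h13 * \<psi>)"
    unfolding h12(1)[symmetric] h13[symmetric] h23[symmetric] by (simp add: algebra_simps)
  then have "(hZ ^ K * h12) * \<psi> = (hX ^ K * (- h23) + hY ^ K * h13) * \<psi>"
    by (simp add: algebra_simps)
  then have "hZ ^ K * h12 = hX ^ K * (- h23) + hY ^ K * h13" using nz by simp
  then obtain g1 g2 where g: "h12 = hY ^ K * g1 + hX ^ K * g2" by (rule cancel_hZ_modulo_hX_hY)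
  have "hY ^ K * (a1 - g1 * \<psi>) = hX ^ K * (a2 + g2 * \<psi>)"
    using h12(1) unfolding g by (simp add: algebra_simps)
  then have "hX ^ K dvd a1 - g1 * \<psi>" by - (rule hX_power_dvd_cancel, simp)
  then obtain A where A: "a1 - g1 * \<psi> = hX ^ K * A" by (rule dvdE)
  have "hY ^ K * (b1 + g1 * \<phi>) = hX ^ K * (b2 - g2 * \<phi>)"
    using h12(2) unfolding g by (simp add: algebra_simps)
  then have "hX ^ K dvd b1 + g1 * \<phi>" by - (rule hX_power_dvd_cancel, simp)
  then obtain B where B: "b1 + g1 * \<phi> = hX ^ K * B" by (rule dvdE)
  have "hX ^ K * f = (a1 - g1 * \<psi>) * \<phi> + (b1 + g1 * \<phi>) * \<psi>"
    using 1 by (simp add: algebra_simps)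
  also have "\<dots> = hX ^ K * (A * \<phi> + B * \<psi>)" unfolding A B by (simp add: algebra_simps)
  finally have "f = A * \<phi> + B * \<psi>" by simp
  then show ?thesis unfolding in_ideal_def by blast
qed

section \<open>Homogeneous components of the cofactors\<close>

lemma homogeneous_part:
  "\<exists>G. homogeneous (int d) G \<and> (\<forall>i j k. i + j + k = d \<longrightarrow> cf3 G i j k = cf3 F i j k)"
proof -
  define G where "G = (\<Sum>i\<le>d. monom (\<Sum>j\<le>d - i. monom (monom (cf3 F i j (d - i - j)) (d - i - j)) j) i)"
  have G: "cf3 G i j k = (if i + j + k = d then cf3 F i j k else 0)" for i j k
  proof -
    have "coeff G i = (if i \<le> d then (\<Sum>j\<le>d - i. monom (monom (cf3 F i j (d - i - j)) (d - i - j)) j) else 0)"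
      by (simp add: G_def coeff_sum)
    then have "coeff (coeff G i) j = (if i + j \<le> d then monom (cf3 F i j (d - i - j)) (d - i - j) else 0)"
      by (auto simp: coeff_sum)
    then show ?thesis by auto
  qed
  have "homogeneous (int d) G" unfolding homogeneous_def by (auto simp: G split: if_splits)
  then show ?thesis by (intro exI[of _ G]) (simp add: G)
qed

text \<open>As \<open>\<phi>\<close> is homogeneous of degree \<open>p\<close>, only the component
  of \<open>F\<close> of degree \<open>n - p\<close> contributes to degree \<open>n\<close> of the
  product; for \<open>n < p\<close> nothing does, and the factor is 0.\<close>

lemma homogeneous_factor:
  assumes \<phi>: "homogeneous (int p) \<phi>"
  shows "\<exists>G. homogeneous (int n - int p) G \<and>
    (\<forall>i j k. i + j + k = n \<longrightarrow> cf3 (G * \<phi>) i j k = cf3 (F * \<phi>) i j k)"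
proof (cases "p \<le> n")
  case True
  obtain G where G: "homogeneous (int (n - p)) G" "\<forall>i j k. i + j + k = n - p \<longrightarrow> cf3 G i j k = cf3 F i j k"
    using homogeneous_part by blast
  have "cf3 (G * \<phi>) i j k = cf3 (F * \<phi>) i j k" if n: "i + j + k = n" for i j k
    unfolding cf3_mult
  proof (intro sum.cong refl)
    fix a b c assume "a \<in> {..i}" "b \<in> {..j}" "c \<in> {..k}"
    show "cf3 G a b c * cf3 \<phi> (i - a) (j - b) (k - c) = cf3 F a b c * cf3 \<phi> (i - a) (j - b) (k - c)"
    proof (cases "(i - a) + (j - b) + (k - c) = p")
      case p: True
      then have "a + b + c = n - p" using n \<open>a \<in> _\<close> \<open>b \<in> _\<close> \<open>c \<in> _\<close> by auto
      then show ?thesis using G(2) by simp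
    next
      case False
      then have "cf3 \<phi> (i - a) (j - b) (k - c) = 0" using homogeneousD[OF \<phi>] by simp
      then show ?thesis by simp
    qed
  qed
  then show ?thesis using G(1) True by (intro exI[of _ G]) (simp add: of_nat_diff)
next
  case False
  have "cf3 (0 * \<phi>) i j k = cf3 (F * \<phi>) i j k" if n: "i + j + k = n" for i j k
  proof -
    have z: "cf3 F a b c * cf3 \<phi> (i - a) (j - b) (k - c) = 0" for a b c
      using homogeneousD[OF \<phi>, of "i - a" "j - b" "k - c"] n False by auto
    show ?thesis unfolding cf3_mult z by simp
  qed
  then show ?thesis by (intro exI[of _ 0]) simp
qed

lemma homogeneous_representation:
  assumes "homogeneous (int p) \<phi>" "homogeneous (int q) \<psi>" "homogeneous (int n) f" "in_ideal \<phi> \<psi> f"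
  obtains A B where "f = A * \<phi> + B * \<psi>" "homogeneous (int n - int p) A" "homogeneous (int n - int q) B"
proof -
  obtain A0 B0 where f: "f = A0 * \<phi> + B0 * \<psi>" using assms(4) unfolding in_ideal_def by blast
  obtain A where A: "homogeneous (int n - int p) A"
    "\<forall>i j k. i + j + k = n \<longrightarrow> cf3 (A * \<phi>) i j k = cf3 (A0 * \<phi>) i j k"
    using homogeneous_factor[OF assms(1)] by blast
  obtain B where B: "homogeneous (int n - int q) B"
    "\<forall>i j k. i + j + k = n \<longrightarrow> cf3 (B * \<psi>) i j k = cf3 (B0 * \<psi>) i j k"
    using homogeneous_factor[OF assms(2)] by blast
  have h: "homogeneous (int n) (A * \<phi> + B * \<psi>)"
    using homogeneous_mult[OF A(1) assms(1)] homogeneous_mult[OF B(1) assms(2)]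
    by (intro homogeneous_add) simp_all
  have "f = A * \<phi> + B * \<psi>"
  proof (rule poly3_eqI)
    fix i j k
    show "cf3 f i j k = cf3 (A * \<phi> + B * \<psi>) i j k"
    proof (cases "i + j + k = n")
      case True
      then show ?thesis using A(2) B(2) by (simp add: f)
    next
      case False
      then show ?thesis using homogeneousD[OF h, of i j k] homogeneousD[OF assms(3), of i j k] by simp
    qed
  qed
  then show thesis using that A(1) B(1) by blast
qed

text \<open>Transfer of \<open>local_noether\<close> from the chart centred at the point. The first
  part homogenises the local multiplier; the second takes the multiplier 1 and so covers every
  representation of \<open>f\<close>.\<close>

lemma local_noether_at_point:
  assumes curves: "plane_curve p \<phi>" "plane_curve q \<psi>" "plane_curve n f" and cop: "coprime \<phi> \<psi>"
    and pass: "\<forall>Q\<in>common_points \<phi> \<psi>.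
           passes_through (\<lambda>R. multiplicity_at \<phi> R + multiplicity_at \<psi> R - 1) f Q"
    and P: "(a, b, c) \<noteq> (0, 0, 0)"
  shows "\<exists>U. ev3 U a b c \<noteq> 0 \<and> in_ideal \<phi> \<psi> (U * f)"
    and "f = A * \<phi> + B * \<psi> \<Longrightarrow> ((a, b, c), ds) \<in> common_points \<phi> \<psi> \<Longrightarrow>
      passes_through (\<lambda>R. multiplicity_at \<psi> R - 1) A ((a, b, c), ds) \<and>
      passes_through (\<lambda>R. multiplicity_at \<phi> R - 1) B ((a, b, c), ds)"
proof -
  have h: "homogeneous (int p) \<phi>" "homogeneous (int q) \<psi>" "homogeneous (int n) f"
    and nz: "\<phi> \<noteq> 0" "\<psi> \<noteq> 0"
    using curves by (simp_all add: plane_curve_def)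
  obtain m1 m2 m3 l1 l2 l3 s where chart: "affine_chart m1 m2 m3 l1 l2 l3"
    and loc_eq: "\<And>F. local_eq F (a, b, c) = subst3 F m1 m2 m3"
    and s: "s \<noteq> 0" "a = s * ev2 m1 0 0" "b = s * ev2 m2 0 0" "c = s * ev2 m3 0 0"
    using local_eq_chart[OF P] by metis
  interpret affine_chart m1 m2 m3 l1 l2 l3 by (rule chart)
  have eq: "local_eq F (a, b, c) = res F" for F by (simp only: loc_eq res_def)
  have cop': "coprime (res \<phi>) (res \<psi>)" by (rule coprime_res[OF cop h(1,2)])
  have nz': "res \<phi> \<noteq> 0" "res \<psi> \<noteq> 0"
    using res_eq_0[OF h(1)] res_eq_0[OF h(2)] nz by blast+
  obtain D where D: "colength_le D (res \<phi>) (res \<psi>)" using colength_finite[OF cop'] .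
  have common: "((a, b, c), ds) \<in> common_points \<phi> \<psi> \<longleftrightarrow>
      1 \<le> near_mult (res \<phi>) ds \<and> 1 \<le> near_mult (res \<psi>) ds" for ds
    using P by (simp add: common_points_def multiplicity_at_def eq del: local_eq.simps)
  have "order_at_least (near_mult (res \<phi>) ds + near_mult (res \<psi>) ds - 1)
      (virtual_transform (\<lambda>ds. near_mult (res \<phi>) ds + near_mult (res \<psi>) ds - 1) (res f) ds)"
    if "1 \<le> near_mult (res \<phi>) ds" "1 \<le> near_mult (res \<psi>) ds" for ds
    using pass[rule_format, of "((a, b, c), ds)"] that
    by (simp add: common passes_through_def multiplicity_at_def eq del: local_eq.simps)
  note local = local_noether[OF D cop' nz' this]
  show "\<exists>U. ev3 U a b c \<noteq> 0 \<and> in_ideal \<phi> \<psi> (U * f)"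
  proof -
    obtain u where u: "ev2 u 0 0 \<noteq> 0" "in_ideal (res \<phi>) (res \<psi>) (u * res f)"
      using local unfolding in_local_ideal_def by blast
    obtain N U where U: "homogeneous (int N) U" "res U = u" "in_ideal \<phi> \<psi> (U * f)"
      using in_ideal_res_lift[OF h u(2)] .
    have "ev3 U a b c = s ^ N * ev2 (res U) 0 0"
      unfolding s(2-4) by (simp only: ev3_homogeneous[OF U(1)] ev2_res)
    then have "ev3 U a b c \<noteq> 0" using s(1) u(1) U(2) by simp
    then show ?thesis using U(3) by blast
  qed
  show "passes_through (\<lambda>R. multiplicity_at \<psi> R - 1) A ((a, b, c), ds) \<and>
      passes_through (\<lambda>R. multiplicity_at \<phi> R - 1) B ((a, b, c), ds)"
    if f: "f = A * \<phi> + B * \<psi>" and Q: "((a, b, c), ds) \<in> common_points \<phi> \<psi>"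
  proof -
    have "1 * res f = res A * res \<phi> + res B * res \<psi>" by (simp add: f)
    then have "order_at_least (near_mult (res \<psi>) ds - 1) (virtual_transform (\<lambda>ds. near_mult (res \<psi>) ds - 1) (res A) ds) \<and>
      order_at_least (near_mult (res \<phi>) ds - 1) (virtual_transform (\<lambda>ds. near_mult (res \<phi>) ds - 1) (res B) ds)"
      using local Q unfolding common by blast
    then show ?thesis
      by (simp add: passes_through_def multiplicity_at_def eq del: local_eq.simps)
  qed
qed

theorem mainTheorem1:
  fixes \<phi> \<psi> f :: poly3 and p q n :: nat
  assumes "plane_curve p \<phi>" and "plane_curve q \<psi>" and "plane_curve n f"
    and "coprime \<phi> \<psi>"
    and "\<forall>Q\<in>common_points \<phi> \<psi>.
           passes_through (\<lambda>R. multiplicity_at \<phi> R + multiplicity_at \<psi> R - 1) f Q"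
  shows "\<exists>A B :: poly3.
           f = A * \<phi> + B * \<psi> \<and>
           homogeneous (int n - int p) A \<and> homogeneous (int n - int q) B \<and>
           (\<forall>Q\<in>common_points \<phi> \<psi>.
              passes_through (\<lambda>R. multiplicity_at \<psi> R - 1) A Q \<and>
              passes_through (\<lambda>R. multiplicity_at \<phi> R - 1) B Q)"
proof -
  have h: "homogeneous (int p) \<phi>" "homogeneous (int q) \<psi>" "homogeneous (int n) f" and nz: "\<psi> \<noteq> 0"
    using assms by (simp_all add: plane_curve_def)
  have in_local_ideal: "\<exists>U. ev3 U a b c \<noteq> 0 \<and> in_ideal \<phi> \<psi> (U * f)" if "(a, b, c) \<noteq> (0, 0, 0)" for a b c
    using local_noether_at_point(1)[OF assms that] .
  obtain K1 where K1: "in_ideal \<phi> \<psi> (hX ^ K1 * f)"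
    using affine_chart.power_in_ideal[OF affine_chart_X assms(4) h in_local_ideal] .
  obtain K2 where K2: "in_ideal \<phi> \<psi> (hY ^ K2 * f)"
    using affine_chart.power_in_ideal[OF affine_chart_Y assms(4) h in_local_ideal] .
  obtain K3 where K3: "in_ideal \<phi> \<psi> (hZ ^ K3 * f)"
    using affine_chart.power_in_ideal[OF affine_chart_Z assms(4) h in_local_ideal] .
  \<comment> \<open>Gluing the three charts requires one common exponent.\<close>
  have raise: "in_ideal \<phi> \<psi> (l ^ (K1 + K2 + K3) * f)"
    if "in_ideal \<phi> \<psi> (l ^ K * f)" "K \<le> K1 + K2 + K3" for l K
    using in_ideal_mult[OF that(1), of "l ^ (K1 + K2 + K3 - K)"] that(2)
    by (simp add: mult.assoc[symmetric] flip: power_add)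
  have "in_ideal \<phi> \<psi> f"
    by (rule in_ideal_if_powers_in_ideal[OF assms(4) nz raise[OF K1] raise[OF K2] raise[OF K3]]) simp_all
  then obtain A B where AB: "f = A * \<phi> + B * \<psi>"
    "homogeneous (int n - int p) A" "homogeneous (int n - int q) B"
    by (rule homogeneous_representation[OF h])
  \<comment> \<open>\<open>A\<close> and \<open>B\<close> were chosen only for their degrees; the
    multiplicity conditions hold for any representation.\<close>
  have "passes_through (\<lambda>R. multiplicity_at \<psi> R - 1) A Q \<and> passes_through (\<lambda>R. multiplicity_at \<phi> R - 1) B Q"
    if Q: "Q \<in> common_points \<phi> \<psi>" for Q
  proof -
    obtain a b c ds where Q': "Q = ((a, b, c), ds)" by (metis prod.collapse)
    then have "(a, b, c) \<noteq> (0, 0, 0)" using Q by (simp add: common_points_def)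
    then show ?thesis using local_noether_at_point(2)[OF assms _ AB(1)] Q unfolding Q' by blast
  qed
  then show ?thesis using AB by blast
qed

end
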